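(* Let $(X,\rho)$ be a compact metric space carrying an Ahlfors $t$-regular Borel probability measure $\mu$, $0<t<\infty$, let $(r_n)_{n\in\mathbb{N}}$ be a decreasing sequence of positive numbers tending to zero, let $E(\mathbf{x})=\limsup_{n\to\infty}B(x_n,r_n)$ for $\mathbf{x}=(x_n)_{n\in\mathbb{N}}\in\Omega=X^{\mathbb{N}}$, and let $$\alpha=\min\Bigl\{t,\limsup_{n\to\infty}\frac{\log n}{-\log r_n}\Bigr\}.$$ For an analytic set $F\subset X$ put $\mathcal{H}(F)=\{\mathbf{x}\in\Omega\mid E(\mathbf{x})\cap F\neq\emptyset\}$. Then for every analytic set $F\subset X$: (1) $\mathbb{P}(\mathcal{H}(F))=0$ if $\dim_{\mathrm P}F<t-\alpha$; (2) $\mathbb{P}(\mathcal{H}(F))=1$ if $\dim_{\mathrm H}F>t-\alpha$; (3) $\mathbb{P}(\mathcal{H}(F))=1$ if $\dim_{\mathrm P}F>t-\alpha$ and there exists an increasing sequence of positive integers $(k_i)_{i\in\mathbb{N}}$ such that $$\lim_{i\to\infty}\frac{k_{i+1}}{k_i}=1\quad\text{and}\quad\lim_{i\to\infty}\frac{\log_2 n_{k_i}}{k_i}=\alpha,$$ where $n_k=\#\{n\in\mathbb{N}\mid 2^{-(k+1)}\le r_n<2^{-k}\}$.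
   Context: $\mu$ is Ahlfors $t$-regular if there is a constant $0<C<\infty$ such that $C^{-1}r^t\le\mu(B(x,r))\le Cr^t$ for all $x\in X$ and $0<r<\operatorname{diam}X$, where $B(x,r)$ is the closed ball with centre $x$ and radius $r$. $X$ has more than one point. $(\Omega,\mathcal A,\mathbb{P})$ is the completion of the infinite product probability space of countably many copies of $(X,\mathcal B(X),\mu)$, where $\mathcal B(X)$ is the Borel $\sigma$-algebra; so the coordinates $x_n$ are independent and distributed according to $\mu$. The covering set is $E(\mathbf{x})=\limsup_{n\to\infty}B(x_n,r_n)=\bigcap_{k=1}^\infty\bigcup_{n=k}^\infty B(x_n,r_n)$. $\dim_{\mathrm H}$ and $\dim_{\mathrm P}$ are Hausdorff and packing dimension with respect to $\rho$, and $\#A$ is the number of elements of $A$. A set is analytic if it is a continuous image of a Borel set. *)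

theory Defs
  imports "HOL-Probability.Probability"
begin

text \<open>Throughout, the compact metric space is a type of class \<^class>\<open>metric_space\<close> whose universe
  is compact. Sequences written with indices \<open>n = 1, 2, \<dots>\<close> on paper are indexed by
  \<^typ>\<open>nat\<close> from \<open>0\<close> here, so position \<open>n\<close> carries the term number \<open>Suc n\<close>.\<close>

definition ahlfors_regular :: "real \<Rightarrow> 'a::metric_space measure \<Rightarrow> bool" where
  "ahlfors_regular t \<mu> \<longleftrightarrow>
     (\<exists>C>0. \<forall>x. \<forall>r. 0 < r \<and> r < diameter (UNIV :: 'a set) \<longrightarrow>
        inverse C * r powr t \<le> measure \<mu> (cball x r) \<and> measure \<mu> (cball x r) \<le> C * r powr t)"

text \<open>The Borel set is a subset of a Polish space. That space is a type parameter, so a theorem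
  assuming \<open>analytic_set TYPE('b) F\<close> with \<open>'b\<close> a type variable covers continuous images of
  Borel subsets of every Polish space.\<close>

definition analytic_set :: "'b::polish_space itself \<Rightarrow> 'a::topological_space set \<Rightarrow> bool" where
  "analytic_set _ F \<longleftrightarrow>
     (\<exists>(B :: 'b set) f. B \<in> sets borel \<and> continuous_on B f \<and> F = f ` B)"

subsection \<open>Hausdorff dimension\<close>

text \<open>\<^const>\<open>diameter\<close> is meaningful only for bounded sets. Finite covers are included, since the
  covering sets may be empty.\<close>

definition hausdorff_content :: "real \<Rightarrow> real \<Rightarrow> 'a::metric_space set \<Rightarrow> ennreal" where
  "hausdorff_content s \<delta> A =
     (INF U \<in> {U :: nat \<Rightarrow> 'a set.
                 (\<forall>i. bounded (U i) \<and> diameter (U i) \<le> \<delta>) \<and> A \<subseteq> (\<Union>i. U i)}.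
        \<Sum>i. ennreal (diameter (U i) powr s))"

definition hausdorff_measure :: "real \<Rightarrow> 'a::metric_space set \<Rightarrow> ennreal" where
  "hausdorff_measure s A = (SUP \<delta>\<in>{0<..}. hausdorff_content s \<delta> A)"

text \<open>Restricting to \<open>s > 0\<close>, here and for packing measures, does not change the infimum and
  avoids \<open>0 powr 0\<close>. The empty set gets dimension \<open>0\<close>.\<close>

definition hausdorff_dim :: "'a::metric_space set \<Rightarrow> ereal" where
  "hausdorff_dim A = Inf {ereal s | s. s > 0 \<and> hausdorff_measure s A = 0}"

subsection \<open>Packing dimension\<close>

text \<open>A packing is a set of pairs (centre, radius) and not of balls, because in a general metric
  space a ball need not determine its centre and radius. The supremum over countable packings
  is the same as the one over finite packings.\<close>

definition packings :: "real \<Rightarrow> 'a::metric_space set \<Rightarrow> ('a \<times> real) set set" where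
  "packings \<delta> A =
     {D. finite D \<and> (\<forall>(x, q)\<in>D. x \<in> A \<and> 0 < q \<and> q \<le> \<delta>) \<and>
         disjoint_family_on (\<lambda>(x, q). cball x q) D}"

definition packing_premeasure :: "real \<Rightarrow> 'a::metric_space set \<Rightarrow> ennreal" where
  "packing_premeasure s A =
     (INF \<delta>\<in>{0<..}. SUP D\<in>packings \<delta> A. \<Sum>(x, q)\<in>D. ennreal ((2 * q) powr s))"

definition packing_measure :: "real \<Rightarrow> 'a::metric_space set \<Rightarrow> ennreal" where
  "packing_measure s A =
     (INF U \<in> {U :: nat \<Rightarrow> 'a set. A \<subseteq> (\<Union>i. U i)}. \<Sum>i. packing_premeasure s (U i))"

definition packing_dim :: "'a::metric_space set \<Rightarrow> ereal" where
  "packing_dim A = Inf {ereal s | s. s > 0 \<and> packing_measure s A = 0}"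

subsection \<open>Random covering sets\<close>

definition centre_space :: "'a::metric_space measure \<Rightarrow> (nat \<Rightarrow> 'a) measure" where
  "centre_space \<mu> = completion (Pi\<^sub>M UNIV (\<lambda>_. \<mu>))"

definition covering_set :: "(nat \<Rightarrow> real) \<Rightarrow> (nat \<Rightarrow> 'a::metric_space) \<Rightarrow> 'a set" where
  "covering_set r x = (\<Inter>k. \<Union>n\<in>{k..}. cball (x n) (r n))"

definition hitting_event ::
    "'a::metric_space measure \<Rightarrow> (nat \<Rightarrow> real) \<Rightarrow> 'a set \<Rightarrow> (nat \<Rightarrow> 'a) set" where
  "hitting_event \<mu> r F = {x \<in> space (centre_space \<mu>). covering_set r x \<inter> F \<noteq> {}}"

text \<open>The upper limit may be infinite, hence \<^typ>\<open>ereal\<close>. The ratio has its intended meaning as soon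
  as \<open>r n < 1\<close>, hence for all but finitely many \<open>n\<close>.\<close>

definition critical_exponent :: "real \<Rightarrow> (nat \<Rightarrow> real) \<Rightarrow> ereal" where
  "critical_exponent t r =
     min (ereal t) (limsup (\<lambda>n. ereal (ln (real (Suc n)) / - ln (r n))))"

definition scale_count :: "(nat \<Rightarrow> real) \<Rightarrow> nat \<Rightarrow> nat" where
  "scale_count r k = card {n. 1 / 2 ^ (k + 1) \<le> r n \<and> r n < 1 / 2 ^ k}"

text \<open>\<^term>\<open>log 2 0\<close> is \<open>0\<close> in the library, but a scale without any radius has to count as
  \<open>log\<^sub>2 0 = -\<infinity>\<close>.\<close>

definition log2_nat :: "nat \<Rightarrow> ereal" where
  "log2_nat m = (if m = 0 then -\<infinity> else ereal (log 2 (real m)))"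

end

theory Submission
  imports Defs
begin

text \<open>
  The event that \<open>E(x)\<close> meets \<open>F\<close> is governed by the volume of neighbourhoods. A ball
  \<open>B(x\<^sub>n, r\<^sub>n)\<close> meets a set \<open>A\<close> essentially when \<open>x\<^sub>n\<close> lies in the \<open>r\<^sub>n\<close>-neighbourhood of \<open>A\<close>, and
  these events are independent. By the two Borel-Cantelli lemmas, \<open>A\<close> is hit infinitely often
  almost surely or almost never, according to whether the sum of \<open>\<mu>(A\<^bsub>r\<^sub>n\<^esub>)\<close>, the measures of the
  neighbourhoods, diverges or converges.

  Under Ahlfors regularity, \<open>\<mu>(A\<^sub>q)\<close> is comparable with \<open>q\<^sup>t\<close> times the number of disjoint balls
  of radius \<open>q\<close> centred in \<open>A\<close>. Hence \<open>\<mu>(A\<^bsub>2q\<^esub>) \<le> K q\<^bsup>t-s\<^esup>\<close> for all small \<open>q\<close> when the \<open>s\<close>-dimensional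
  packing premeasure of \<open>A\<close> is finite
  (\<open>nbhd_volume_le_if_finite_premeasure\<close>). In the other direction, for \<open>u < s\<close>, the bound
  \<open>\<mu>(A\<^bsub>2q\<^esub>) > q\<^bsup>t-u\<^esup>\<close> holds for all small \<open>q\<close> if the Hausdorff measure of \<open>A\<close> in dimension \<open>s\<close> is
  positive, and for arbitrarily small \<open>q\<close> if the packing measure is. The exponent \<open>\<alpha>\<close> separates
  convergence from divergence of the sum of \<open>r\<^sub>n\<^bsup>v\<^esup>\<close> for \<open>0 < v < t\<close>. If the lower bound on the volume is available only at
  sparse scales \<open>q\<close>, the scales \<open>k\<^sub>i\<close> in the third claim make up for it: the condition
  \<open>k\<^bsub>i+1\<^esub>/k\<^sub>i \<rightarrow> 1\<close> places one of them near every \<open>q\<close>, with roughly \<open>2\<^bsup>\<alpha>k\<^sub>i\<^esup>\<close> radii in it.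

  This settles the first claim, since \<open>F\<close> is covered by countably many sets of finite
  premeasure in some dimension \<open>s < t - \<alpha>\<close>. For the other two it remains to find a single point of \<open>F\<close> lying in infinitely many
  balls, which is a Baire category argument (\<open>AE_covering_set_hits_analytic\<close>). An analytic set is a
  continuous image of a closed set \<open>Z\<close> in a complete separable space, and the null sets of a
  Hausdorff or packing measure form a \<open>\<sigma>\<close>-ideal. Removing from \<open>Z\<close> the basic open pieces with null
  image leaves a closed set \<open>Y\<close> each of whose nonempty open pieces has an image of positive
  measure. There are countably many basic pieces, so almost surely each of their images is hit by
  open balls infinitely often. Then the points of \<open>Y\<close> whose image lies in some ball of index at
  least \<open>k\<close> form a dense open subset of \<open>Y\<close>, for every \<open>k\<close>, and the intersection of these
  subsets is nonempty. The hitting event thus contains almost every sequence and is measurable because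
  the probability space is complete.
\<close>

section \<open>Borel sets as projections of closed sets\<close>

text \<open>
  The sets obtained in this way include the closed sets and are stable under countable unions and
  intersections: for a union the first entry of the sequence names the member of the family and the
  rest is a witness for it, for an intersection one sequence encodes witnesses for all members. In a
  metric space open sets are countable unions of closed ones, so all Borel sets are reached.
\<close>

lemma borel_eq_fst_closed:
  fixes B :: "'b::metric_space set"
  assumes "B \<in> sets borel"
  shows "\<exists>Z :: ('b \<times> (nat \<Rightarrow> nat discrete)) set. closed Z \<and> fst ` Z = B"
proof -
  define S where "S = {B. \<exists>Z :: ('b \<times> (nat \<Rightarrow> nat discrete)) set. closed Z \<and> fst ` Z = B}"
  have closedS: "B \<in> S" if "closed B" for B
    unfolding S_def using that
    by (intro CollectI exI[of _ "B \<times> UNIV"]) (auto intro: closed_Times simp: image_iff)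
  have UnS: "(\<Union>i. A i) \<in> S" if A: "\<And>i :: nat. A i \<in> S" for A
  proof -
    obtain Z :: "nat \<Rightarrow> ('b \<times> (nat \<Rightarrow> nat discrete)) set"
      where Z: "\<And>i. closed (Z i)" "\<And>i. fst ` Z i = A i"
      using A unfolding S_def mem_Collect_eq by metis
    define sh where "sh = (\<lambda>p :: 'b \<times> (nat \<Rightarrow> nat discrete). (fst p, \<lambda>n. snd p (Suc n)))"
    have sh: "continuous_on UNIV sh"
      unfolding sh_def by (intro continuous_intros continuous_on_product_then_coordinatewise)
    define Y where "Y = (\<Inter>i. {p. snd p 0 \<noteq> discrete i} \<union> sh -` Z i)"
    have "closed {p :: 'b \<times> (nat \<Rightarrow> nat discrete). snd p 0 \<noteq> discrete i}" for i
    proof -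
      have "continuous_on UNIV (\<lambda>p :: 'b \<times> (nat \<Rightarrow> nat discrete). snd p 0)"
        by (intro continuous_intros continuous_on_product_then_coordinatewise)
      moreover have "closed (- {discrete i})"
        by (simp add: closed_Compl open_discrete)
      ultimately have "closed ((\<lambda>p :: 'b \<times> (nat \<Rightarrow> nat discrete). snd p 0) -` (- {discrete i}))"
        using closed_vimage by blast
      then show ?thesis by (simp add: vimage_def)
    qed
    then have "closed Y"
      unfolding Y_def using Z(1) sh by (intro closed_INT ballI closed_Un closed_vimage) auto
    moreover have "fst ` Y = (\<Union>i. A i)"
    proof (intro set_eqI iffI)
      fix b assume "b \<in> fst ` Y"
      then obtain \<sigma> where "(b, \<sigma>) \<in> Y" by force
      moreover obtain i where "\<sigma> 0 = discrete i" by (cases "\<sigma> 0") auto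
      ultimately have "sh (b, \<sigma>) \<in> Z i" by (auto simp: Y_def)
      then have "fst (sh (b, \<sigma>)) \<in> fst ` Z i" by blast
      then show "b \<in> (\<Union>i. A i)" using Z(2) by (auto simp: sh_def)
    next
      fix b assume "b \<in> (\<Union>i. A i)"
      then obtain i where "b \<in> fst ` Z i" using Z(2) by auto
      then obtain \<sigma> where "(b, \<sigma>) \<in> Z i" by force
      then have "(b, case_nat (discrete i) \<sigma>) \<in> Y"
        by (auto simp: Y_def sh_def discrete_inject)
      then show "b \<in> fst ` Y" by force
    qed
    ultimately show ?thesis unfolding S_def by blast
  qed
  have IntS: "(\<Inter>i. A i) \<in> S" if A: "\<And>i :: nat. A i \<in> S" for A
  proof -
    obtain Z :: "nat \<Rightarrow> ('b \<times> (nat \<Rightarrow> nat discrete)) set"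
      where Z: "\<And>i. closed (Z i)" "\<And>i. fst ` Z i = A i"
      using A unfolding S_def mem_Collect_eq by metis
    define row where
      "row = (\<lambda>i (p :: 'b \<times> (nat \<Rightarrow> nat discrete)). (fst p, \<lambda>n. snd p (prod_encode (i, n))))"
    have row: "continuous_on UNIV (row i)" for i
      unfolding row_def by (intro continuous_intros continuous_on_product_then_coordinatewise)
    define Y where "Y = (\<Inter>i. row i -` Z i)"
    have "closed Y"
      unfolding Y_def using Z(1) row by (intro closed_INT ballI closed_vimage) auto
    moreover have "fst ` Y = (\<Inter>i. A i)"
    proof (intro set_eqI iffI)
      fix b assume "b \<in> fst ` Y"
      then obtain \<sigma> where "\<And>i. row i (b, \<sigma>) \<in> Z i" by (force simp: Y_def)
      then have "fst (row i (b, \<sigma>)) \<in> A i" for i using Z(2) by blast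
      then show "b \<in> (\<Inter>i. A i)" by (auto simp: row_def)
    next
      fix b assume "b \<in> (\<Inter>i. A i)"
      then have "\<forall>i. \<exists>\<sigma>. (b, \<sigma>) \<in> Z i" using Z(2) by force
      then obtain \<sigma> where "\<And>i. (b, \<sigma> i) \<in> Z i" by metis
      then have "(b, \<lambda>m. case_prod \<sigma> (prod_decode m)) \<in> Y"
        by (auto simp: Y_def row_def)
      then show "b \<in> fst ` Y" by force
    qed
    ultimately show ?thesis unfolding S_def by blast
  qed
  have openS: "- B \<in> S" if "closed B" for B :: "'b set"
  proof (cases "B = {}")
    case True
    then show ?thesis using closedS[of UNIV] by simp
  next
    case False
    have "- B = (\<Union>n. {x. inverse (real (Suc n)) \<le> infdist x B})"
    proof (intro set_eqI iffI)
      fix x assume "x \<in> - B"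
      then have "infdist x B > 0"
        using in_closed_iff_infdist_zero[OF that False, of x] infdist_nonneg[of x B] by simp
      then obtain n where "inverse (real (Suc n)) < infdist x B"
        using reals_Archimedean by blast
      then have "x \<in> {x. inverse (real (Suc n)) \<le> infdist x B}"
        unfolding mem_Collect_eq by (rule less_imp_le)
      then show "x \<in> (\<Union>n. {x. inverse (real (Suc n)) \<le> infdist x B})" by (rule UN_I[OF UNIV_I])
    next
      fix x assume "x \<in> (\<Union>n. {x. inverse (real (Suc n)) \<le> infdist x B})"
      then obtain n where "inverse (real (Suc n)) \<le> infdist x B" by blast
      moreover have "0 < inverse (real (Suc n))" by simp
      ultimately have "0 < infdist x B" by linarith
      then show "x \<in> - B" by auto
    qed
    moreover have "closed {x. inverse (real (Suc n)) \<le> infdist x B}" for n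
      by (intro closed_Collect_le continuous_intros)
    ultimately show ?thesis using UnS[OF closedS] by simp
  qed
  have "B \<in> sigma_sets UNIV (Collect closed)"
    using assms by (simp add: borel_eq_closed)
  \<comment> \<open>Closure under complements is not available for projections, so it is carried along.\<close>
  then have "B \<in> S \<and> - B \<in> S"
  proof induction
    case (Basic a)
    then show ?case using closedS openS by auto
  next
    case Empty
    then show ?case using closedS[of "{}"] closedS[of UNIV] by auto
  next
    case (Compl a)
    then show ?case by (simp add: Compl_eq_Diff_UNIV[symmetric])
  next
    case (Union a)
    then show ?case using UnS[of a] IntS[of "\<lambda>i. - a i"] by simp
  qed
  then show ?thesis unfolding S_def by blast
qed

section \<open>Hitting analytic sets\<close>

definition sigma_ideal :: "'a set set \<Rightarrow> bool" where
  "sigma_ideal N \<longleftrightarrow>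
     {} \<in> N \<and> (\<forall>A\<in>N. \<forall>B\<subseteq>A. B \<in> N) \<and> (\<forall>A :: nat \<Rightarrow> 'a set. (\<forall>n. A n \<in> N) \<longrightarrow> (\<Union>n. A n) \<in> N)"

lemma sigma_ideal_countable_Union:
  assumes N: "sigma_ideal N" "\<A> \<subseteq> N" "countable \<A>"
  shows "\<Union>\<A> \<in> N"
proof (cases "\<A> = {}")
  case True
  then show ?thesis using N(1) unfolding sigma_ideal_def by simp
next
  case False
  then have "\<Union>\<A> = (\<Union>n. from_nat_into \<A> n)"
    using N(3) by (simp add: range_from_nat_into)
  moreover have "from_nat_into \<A> n \<in> N" for n
    using from_nat_into[OF False] N(2) by blast
  ultimately show ?thesis using N(1) unfolding sigma_ideal_def by simp
qed

text \<open>
  There are only countably many basic open sets, so removing all those with image in the ideal does not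
  change the image modulo the ideal, neither globally nor inside an open set.
\<close>

lemma sigma_ideal_kernel:
  fixes Z :: "'c::second_countable_topology set" and g :: "'c \<Rightarrow> 'a"
  assumes N: "sigma_ideal N" and Z: "closed Z" "g ` Z \<notin> N"
  obtains Y where "closed Y" "Y \<subseteq> Z" "Y \<noteq> {}"
    "\<And>V. open V \<Longrightarrow> V \<inter> Y \<noteq> {} \<Longrightarrow> g ` (V \<inter> Y) \<notin> N"
proof -
  obtain \<B> :: "'c set set" where \<B>: "countable \<B>" "topological_basis \<B>"
    using ex_countable_basis by blast
  define \<W> where "\<W> = {V \<in> \<B>. g ` (V \<inter> Z) \<in> N}"
  define Y where "Y = Z - \<Union>\<W>"
  have countW: "countable \<W>" using \<B>(1) unfolding \<W>_def by simp
  have sub: "B \<in> N" if "A \<in> N" "B \<subseteq> A" for A B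
    using N that unfolding sigma_ideal_def by blast
  have small: "g ` (Z \<inter> \<Union>\<W>) \<in> N"
  proof -
    have "\<Union>((\<lambda>V. g ` (V \<inter> Z)) ` \<W>) \<in> N"
      using countW by (intro sigma_ideal_countable_Union[OF N]) (auto simp: \<W>_def)
    then show ?thesis by (rule sub) auto
  qed
  have Un: "A \<union> B \<in> N" if "A \<in> N" "B \<in> N" for A B
    using sigma_ideal_countable_Union[OF N, of "{A, B}"] that by simp
  show thesis
  proof
    show "closed Y"
      unfolding Y_def using Z(1) \<B>(2)
      by (intro closed_Diff open_Union) (auto simp: \<W>_def topological_basis_open)
    show "Y \<subseteq> Z" by (auto simp: Y_def)
    show "Y \<noteq> {}"
    proof
      assume "Y = {}"
      then have "Z = Z \<inter> \<Union>\<W>" by (auto simp: Y_def)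
      then show False using small Z(2) by metis
    qed
    fix V assume V: "open V" "V \<inter> Y \<noteq> {}"
    then obtain y where y: "y \<in> V" "y \<in> Y" by blast
    obtain B where B: "B \<in> \<B>" "y \<in> B" "B \<subseteq> V"
      using topological_basisE[OF \<B>(2) V(1) y(1)] by blast
    show "g ` (V \<inter> Y) \<notin> N"
    proof
      assume "g ` (V \<inter> Y) \<in> N"
      then have "g ` (V \<inter> Y) \<union> g ` (Z \<inter> \<Union>\<W>) \<in> N" using small by (rule Un)
      then have "g ` (B \<inter> Z) \<in> N" by (rule sub) (use B(3) in \<open>auto simp: Y_def\<close>)
      then have "B \<in> \<W>" using B(1) by (simp add: \<W>_def)
      then show False using y(2) B(2) by (auto simp: Y_def)
    qed
  qed
qed

text \<open>
  The category theorem on a closed subset of a complete space, with density tested by open sets of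
  the ambient space.
\<close>

lemma Baire_closed_subset:
  fixes Y :: "'c::complete_space set"
  assumes Y: "closed Y" "Y \<noteq> {}"
    and opn: "\<And>k :: nat. openin (top_of_set Y) (D k)"
    and dense: "\<And>k V. open V \<Longrightarrow> V \<inter> Y \<noteq> {} \<Longrightarrow> V \<inter> D k \<noteq> {}"
  shows "(\<Inter>k. D k) \<noteq> {}"
proof -
  have D_sub: "D k \<subseteq> Y" for k using opn openin_imp_subset by blast
  have "top_of_set Y closure_of \<Inter>(range D) = topspace (top_of_set Y)"
  proof (rule Baire_category)
    show "completely_metrizable_space (top_of_set Y) \<or>
        locally_compact_space (top_of_set Y) \<and> regular_space (top_of_set Y)"
      using completely_metrizable_space_closedin[OF completely_metrizable_space_euclidean, of Y] Y(1)
      unfolding closed_closedin by blast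
    show "countable (range D)" by simp
    fix T assume "T \<in> range D"
    then obtain k where k: "T = D k" by blast
    have "\<exists>y. y \<in> D k \<and> y \<in> U" if U: "openin (top_of_set Y) U" "x \<in> U" for x U
    proof -
      obtain V where V: "open V" "U = Y \<inter> V" using U(1) openin_open by blast
      then have "V \<inter> D k \<noteq> {}" using dense[OF V(1)] U(2) by blast
      then show ?thesis using V(2) D_sub by blast
    qed
    then show "openin (top_of_set Y) T \<and> top_of_set Y closure_of T = topspace (top_of_set Y)"
      using opn unfolding k by (auto simp: closure_of_def Bex_def)
  qed
  then show ?thesis using Y(2) by auto
qed

text \<open>
  The second Borel-Cantelli lemma for coordinates: avoiding \<open>U n\<close> for all \<open>n\<close> in a finite set has
  probability at most the product of \<open>1 - \<mu> (U n)\<close>, which is at most the exponential of minus the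
  sum of the \<open>\<mu> (U n)\<close>.
\<close>

lemma AE_infinitely_often:
  assumes "prob_space \<mu>" and U: "\<And>n. U n \<in> sets \<mu>"
    and div: "\<not> summable (\<lambda>n. measure \<mu> (U n))"
  shows "AE x in Pi\<^sub>M UNIV (\<lambda>_ :: nat. \<mu>). \<forall>k. \<exists>n\<ge>k. x n \<in> U n"
proof -
  interpret prob_space \<mu> by fact
  interpret P: product_prob_space "\<lambda>_. \<mu>" "UNIV :: nat set" by unfold_locales
  let ?P = "Pi\<^sub>M UNIV (\<lambda>_ :: nat. \<mu>)"
  have "AE x in ?P. \<exists>n\<ge>k. x n \<in> U n" for k
  proof -
    define B where "B = {x \<in> space ?P. \<forall>n\<ge>k. x n \<in> space \<mu> - U n}"
    have Bm: "B \<in> sets ?P"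
      unfolding B_def using U by measurable
    have bound: "P.prob B \<le> exp (- (\<Sum>n\<in>{k..<m}. prob (U n)))" for m
    proof -
      have "P.prob B \<le> P.prob {x \<in> space ?P. \<forall>n\<in>{k..<m}. x n \<in> space \<mu> - U n}"
      proof (rule P.finite_measure_mono)
        show "{x \<in> space ?P. \<forall>n\<in>{k..<m}. x n \<in> space \<mu> - U n} \<in> sets ?P"
          using U by measurable
      qed (auto simp: B_def)
      also have "\<dots> = (\<Prod>n\<in>{k..<m}. prob (space \<mu> - U n))"
      proof -
        have "emeasure ?P {x \<in> space ?P. \<forall>n\<in>{k..<m}. x n \<in> space \<mu> - U n} =
            (\<Prod>n\<in>{k..<m}. emeasure \<mu> (space \<mu> - U n))"
          using U by (intro P.emeasure_PiM_Collect) auto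
        then show ?thesis
          by (simp add: P.emeasure_eq_measure emeasure_eq_measure prod_ennreal prod_nonneg)
      qed
      also have "\<dots> \<le> (\<Prod>n\<in>{k..<m}. exp (- prob (U n)))"
      proof (intro prod_mono conjI)
        fix n
        show "prob (space \<mu> - U n) \<le> exp (- prob (U n))"
          using exp_ge_add_one_self[of "- prob (U n)"] U by (simp add: prob_compl)
      qed simp
      finally show ?thesis by (simp add: exp_sum[symmetric] sum_negf)
    qed
    have "\<not> (0 < P.prob B)"
    proof
      assume pos: "0 < P.prob B"
      have "summable (\<lambda>n. prob (U (n + k)))"
      proof (rule summableI_nonneg_bounded)
        fix m
        have "(\<Sum>n<m. prob (U (n + k))) = (\<Sum>n\<in>{k..<m + k}. prob (U n))"
          using sum.shift_bounds_nat_ivl[of "\<lambda>n. prob (U n)" 0 k m] by (simp add: lessThan_atLeast0)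
        moreover have "ln (P.prob B) \<le> - (\<Sum>n\<in>{k..<m + k}. prob (U n))"
          using ln_le_cancel_iff[OF pos, of "exp (- (\<Sum>n\<in>{k..<m + k}. prob (U n)))"] bound[of "m + k"]
          by simp
        ultimately show "(\<Sum>n<m. prob (U (n + k))) \<le> - ln (P.prob B)" by simp
      qed simp
      then show False using div summable_iff_shift[of "\<lambda>n. prob (U n)" k] by blast
    qed
    then have "P.prob B = 0" using measure_nonneg[of ?P B] by linarith
    then have "B \<in> null_sets ?P" using Bm by (auto simp: P.emeasure_eq_measure)
    then show ?thesis
      by (rule AE_I') (auto simp: B_def space_PiM)
  qed
  then show ?thesis by (simp add: AE_all_countable)
qed

definition nbhd :: "'a::metric_space set \<Rightarrow> real \<Rightarrow> 'a set" where
  "nbhd A q = (\<Union>a\<in>A. ball a q)"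

lemma open_nbhd: "open (nbhd A q)"
  by (simp add: nbhd_def open_UN)

lemma nbhd_mono: "p \<le> q \<Longrightarrow> nbhd A p \<subseteq> nbhd A q"
  unfolding nbhd_def by (force simp: subset_ball)

text \<open>
  Almost surely every basic open piece of the kernel \<open>Y\<close> has its image hit infinitely often. On this
  event the argument is purely topological: the preimages of the unions of open balls of index at
  least \<open>k\<close> are dense and open in \<open>Y\<close>.
\<close>

lemma AE_covering_set_hits_analytic:
  fixes \<mu> :: "'a::metric_space measure" and F :: "'a set"
  assumes prob: "prob_space \<mu>" and borel: "sets \<mu> = sets borel"
    and N: "sigma_ideal N"
    and div: "\<And>A. A \<notin> N \<Longrightarrow> \<not> summable (\<lambda>n. measure \<mu> (nbhd A (r n)))"
    and F: "analytic_set TYPE('b::polish_space) F" "F \<notin> N"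
  shows "AE x in Pi\<^sub>M UNIV (\<lambda>_. \<mu>). covering_set r x \<inter> F \<noteq> {}"
proof -
  obtain B :: "'b set" and f where B: "B \<in> sets borel" "continuous_on B f" "F = f ` B"
    using F(1) unfolding analytic_set_def by blast
  obtain Z :: "('b \<times> (nat \<Rightarrow> nat discrete)) set" where Z: "closed Z" "fst ` Z = B"
    using borel_eq_fst_closed[OF B(1)] by blast
  define g :: "'b \<times> (nat \<Rightarrow> nat discrete) \<Rightarrow> 'a" where "g = f \<circ> fst"
  have g: "continuous_on Z g"
    using B(2) Z(2) unfolding g_def
    by (intro continuous_on_compose continuous_on_fst continuous_on_id) simp
  have gZ: "g ` Z = F"
    unfolding g_def image_comp[symmetric] B(3) Z(2) ..
  obtain Y where Y: "closed Y" "Y \<subseteq> Z" "Y \<noteq> {}"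
    and Y_large: "\<And>V. open V \<Longrightarrow> V \<inter> Y \<noteq> {} \<Longrightarrow> g ` (V \<inter> Y) \<notin> N"
    using sigma_ideal_kernel[OF N Z(1), of g] F(2) gZ by metis
  obtain \<B> :: "('b \<times> (nat \<Rightarrow> nat discrete)) set set"
    where \<B>: "countable \<B>" "topological_basis \<B>"
    using ex_countable_basis by blast
  have "AE x in Pi\<^sub>M UNIV (\<lambda>_. \<mu>). \<forall>V\<in>\<B>. V \<inter> Y \<noteq> {} \<longrightarrow>
      (\<forall>k. \<exists>n\<ge>k. x n \<in> nbhd (g ` (V \<inter> Y)) (r n))"
  proof (rule AE_ball_countable'[OF _ \<B>(1)])
    fix V assume V: "V \<in> \<B>"
    show "AE x in Pi\<^sub>M UNIV (\<lambda>_. \<mu>). V \<inter> Y \<noteq> {} \<longrightarrow>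
      (\<forall>k. \<exists>n\<ge>k. x n \<in> nbhd (g ` (V \<inter> Y)) (r n))"
    proof (cases "V \<inter> Y = {}")
      case False
      then have "\<not> summable (\<lambda>n. measure \<mu> (nbhd (g ` (V \<inter> Y)) (r n)))"
        using V \<B>(2) by (intro div Y_large) (auto simp: topological_basis_open)
      then have "AE x in Pi\<^sub>M UNIV (\<lambda>_. \<mu>). \<forall>k. \<exists>n\<ge>k. x n \<in> nbhd (g ` (V \<inter> Y)) (r n)"
        by (intro AE_infinitely_often prob) (simp add: borel open_nbhd)
      then show ?thesis by simp
    qed simp
  qed
  then show ?thesis
  proof eventually_elim
    case (elim x)
    define G where "G = (\<lambda>k. \<Union>n\<in>{k..}. ball (x n) (r n))"
    define D where "D = (\<lambda>k. Y \<inter> g -` G k)"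
    have "(\<Inter>k. D k) \<noteq> {}"
    proof (rule Baire_closed_subset[OF Y(1,3)])
      show "openin (top_of_set Y) (D k)" for k
        unfolding D_def G_def using continuous_on_subset[OF g Y(2)]
        by (intro continuous_openin_preimage_gen open_UN) auto
      fix k V assume "open V" "V \<inter> Y \<noteq> {}"
      then obtain y where y: "y \<in> V" "y \<in> Y" by blast
      obtain W where W: "W \<in> \<B>" "y \<in> W" "W \<subseteq> V"
        using topological_basisE[OF \<B>(2) \<open>open V\<close> y(1)] by blast
      then obtain n z where "n \<ge> k" "z \<in> W \<inter> Y" "x n \<in> ball (g z) (r n)"
        using elim y(2) unfolding nbhd_def by blast
      then have "z \<in> V \<inter> D k"
        using W(3) by (auto simp: D_def G_def dist_commute)
      then show "V \<inter> D k \<noteq> {}" by blast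
    qed
    then obtain z where z: "z \<in> D k" for k by blast
    then have "g z \<in> F" using Y(2) gZ unfolding D_def by blast
    moreover have "g z \<in> covering_set r x"
      using z unfolding covering_set_def D_def G_def by (force simp: less_imp_le)
    ultimately show ?case by blast
  qed
qed

section \<open>Null sets of Hausdorff and packing measures\<close>

text \<open>
  Hausdorff contents and packing measures are both infima of a total cost over countable covers,
  restricted to sets with a property \<open>P\<close>. Their null sets are closed under countable unions because
  covers can be chosen with costs \<open>e / 2\<^bsup>n + 1\<^esup>\<close>.
\<close>

lemma countable_cover_cost_UN_eq_0:
  fixes c :: "'a set \<Rightarrow> ennreal" and A :: "nat \<Rightarrow> 'a set"
  assumes zero: "\<And>n. (INF U\<in>{U :: nat \<Rightarrow> 'a set. (\<forall>i. P (U i)) \<and> A n \<subseteq> (\<Union>i. U i)}. \<Sum>i. c (U i)) = 0"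
  shows "(INF U\<in>{U :: nat \<Rightarrow> 'a set. (\<forall>i. P (U i)) \<and> (\<Union>n. A n) \<subseteq> (\<Union>i. U i)}. \<Sum>i. c (U i)) = 0"
    (is "?I = 0")
proof -
  have "?I \<le> 0 + ennreal e" if e: "0 < e" for e
  proof -
    have "\<exists>U. (\<forall>i. P (U i)) \<and> A n \<subseteq> (\<Union>i. U i) \<and> (\<Sum>i. c (U i)) < ennreal (e * (1 / 2) ^ Suc n)"
      for n
    proof -
      have "(INF U\<in>{U :: nat \<Rightarrow> 'a set. (\<forall>i. P (U i)) \<and> A n \<subseteq> (\<Union>i. U i)}. \<Sum>i. c (U i))
          < ennreal (e * (1 / 2) ^ Suc n)"
        unfolding zero using e by (simp add: ennreal_zero_less_divide)
      then show ?thesis unfolding INF_less_iff by blast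
    qed
    then obtain U where U: "\<And>n i. P (U n i)" "\<And>n. A n \<subseteq> (\<Union>i. U n i)"
      "\<And>n. (\<Sum>i. c (U n i)) < ennreal (e * (1 / 2) ^ Suc n)" by metis
    define V where "V = (\<lambda>m. U (fst (prod_decode m)) (snd (prod_decode m)))"
    have "(\<Sum>m. c (V m)) = (\<Sum>n. \<Sum>i. c (U n i))"
      unfolding V_def by (rule suminf_ennreal_2dimen[where f = "\<lambda>p. c (U (fst p) (snd p))"]) simp
    also have "\<dots> \<le> (\<Sum>n. ennreal (e * (1 / 2) ^ Suc n))"
      using U(3) by (intro suminf_le) (auto intro: less_imp_le)
    also have "\<dots> = ennreal e"
      using sums_mult[OF power_half_series, of e] e by (intro suminf_ennreal_eq) auto
    finally have le: "(\<Sum>m. c (V m)) \<le> ennreal e" .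
    have "(\<Union>n. A n) \<subseteq> (\<Union>m. V m)"
    proof
      fix x assume "x \<in> (\<Union>n. A n)"
      then obtain n i where "x \<in> U n i" using U(2) by blast
      then have "x \<in> V (prod_encode (n, i))" by (simp add: V_def)
      then show "x \<in> (\<Union>m. V m)" by blast
    qed
    moreover have "P (V m)" for m using U(1) by (simp add: V_def)
    ultimately have "?I \<le> (\<Sum>m. c (V m))" by (intro INF_lower) simp
    with le show ?thesis by simp
  qed
  then have "?I \<le> 0" by (rule ennreal_le_epsilon)
  then show ?thesis by simp
qed

lemma hausdorff_measure_eq_0_iff:
  "hausdorff_measure s A = 0 \<longleftrightarrow> (\<forall>\<delta>>0. hausdorff_content s \<delta> A = 0)"
  by (auto simp: hausdorff_measure_def SUP_eq_iff bot_ennreal[symmetric])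

lemma sigma_ideal_hausdorff_null:
  "sigma_ideal {A :: 'a::metric_space set. hausdorff_measure s A = 0}"
proof -
  have sub: "hausdorff_content s \<delta> B = 0" if "hausdorff_content s \<delta> A = 0" "B \<subseteq> A"
    for \<delta> and A B :: "'a set"
  proof -
    have "hausdorff_content s \<delta> B \<le> hausdorff_content s \<delta> A"
      unfolding hausdorff_content_def using that(2) by (intro INF_superset_mono) auto
    then show ?thesis using that(1) by simp
  qed
  have empty: "hausdorff_content s \<delta> ({} :: 'a set) = 0" if "0 < \<delta>" for \<delta>
  proof -
    have "hausdorff_content s \<delta> ({} :: 'a set) \<le> (\<Sum>i :: nat. ennreal (diameter ({} :: 'a set) powr s))"
      unfolding hausdorff_content_def using that by (intro INF_lower) simp
    then show ?thesis by simp
  qed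
  have un: "hausdorff_content s \<delta> (\<Union>n. A n) = 0" if "\<And>n. hausdorff_content s \<delta> (A n) = 0"
    for \<delta> and A :: "nat \<Rightarrow> 'a set"
    using that unfolding hausdorff_content_def by (rule countable_cover_cost_UN_eq_0)
  show ?thesis
    unfolding sigma_ideal_def hausdorff_measure_eq_0_iff mem_Collect_eq
    using empty sub un by blast
qed

lemma packing_premeasure_empty: "packing_premeasure s {} = 0"
proof -
  have "packings \<delta> ({} :: 'a::metric_space set) = {{}}" for \<delta> :: real
    by (auto simp: packings_def disjoint_family_on_def)
  then show ?thesis by (simp add: packing_premeasure_def)
qed

lemma packing_measure_le_premeasure: "packing_measure s A \<le> packing_premeasure s A"
proof -
  have "packing_measure s A \<le> (\<Sum>i. packing_premeasure s (if i = (0 :: nat) then A else {}))"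
    unfolding packing_measure_def by (rule INF_lower) auto
  also have "\<dots> = (\<Sum>i\<in>{0 :: nat}. packing_premeasure s (if i = 0 then A else {}))"
    by (rule suminf_finite) (auto simp: packing_premeasure_empty)
  finally show ?thesis by simp
qed

lemma sigma_ideal_packing_null:
  "sigma_ideal {A :: 'a::metric_space set. packing_measure s A = 0}"
proof -
  have "packing_measure s B = 0" if "packing_measure s A = 0" "B \<subseteq> A" for A B :: "'a set"
  proof -
    have "packing_measure s B \<le> packing_measure s A"
      unfolding packing_measure_def using that(2) by (intro INF_superset_mono) auto
    then show ?thesis using that(1) by simp
  qed
  moreover have "packing_measure s (\<Union>n. A n) = 0" if "\<And>n. packing_measure s (A n) = 0"
    for A :: "nat \<Rightarrow> 'a set"
    using countable_cover_cost_UN_eq_0[where P = "\<lambda>_. True" and A = A and c = "packing_premeasure s"] that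
    unfolding packing_measure_def by simp
  moreover have "packing_measure s ({} :: 'a set) = 0"
    using packing_measure_le_premeasure[of s "{} :: 'a set"] by (simp add: packing_premeasure_empty)
  ultimately show ?thesis unfolding sigma_ideal_def mem_Collect_eq by blast
qed

section \<open>Dimension and the volume of neighbourhoods\<close>

locale regular_prob_space = prob_space \<mu> for \<mu> :: "'a::metric_space measure" +
  fixes t C R :: real
  assumes sets_borel: "sets \<mu> = sets borel"
    and C_pos: "0 < C" and R_pos: "0 < R"
    and cball_lower: "\<And>x q. 0 < q \<Longrightarrow> q < R \<Longrightarrow> inverse C * q powr t \<le> prob (cball x q)"
    and cball_upper: "\<And>x q. 0 < q \<Longrightarrow> q < R \<Longrightarrow> prob (cball x q) \<le> C * q powr t"
begin

text \<open>
  Disjoint balls of radius \<open>q\<close> centred in \<open>A\<close> lie in the neighbourhood of radius \<open>2 q\<close> and each of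
  them has measure at least \<open>q\<^sup>t / C\<close>. Indices instead of centres allow for families that are
  already indexed by centre-radius pairs.
\<close>

lemma card_disjoint_balls_le:
  fixes c :: "'i \<Rightarrow> 'a"
  assumes I: "finite I" "disjoint_family_on (\<lambda>i. cball (c i) q) I" "c ` I \<subseteq> A"
    and q: "0 < q" "q < R"
  shows "real (card I) \<le> C * q powr (-t) * prob (nbhd A (2 * q))"
proof -
  have "real (card I) * (inverse C * q powr t) \<le> (\<Sum>i\<in>I. prob (cball (c i) q))"
    using sum_mono[of I "\<lambda>_. inverse C * q powr t" "\<lambda>i. prob (cball (c i) q)"] cball_lower[OF q] by simp
  also have "\<dots> = prob (\<Union>i\<in>I. cball (c i) q)"
    using I by (intro finite_measure_finite_Union[symmetric]) (auto simp: sets_borel)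
  also have "\<dots> \<le> prob (nbhd A (2 * q))"
  proof (rule finite_measure_mono)
    show "(\<Union>i\<in>I. cball (c i) q) \<subseteq> nbhd A (2 * q)"
      using I(3) q(1) by (force simp: nbhd_def)
    show "nbhd A (2 * q) \<in> sets \<mu>" by (simp add: sets_borel open_nbhd)
  qed
  finally show ?thesis
    using C_pos q by (simp add: powr_minus field_simps)
qed

text \<open>
  The volume bound limits the size of a disjoint family of balls, so one of maximal size exists.
  Another point of \<open>A\<close> cannot be added to it, hence lies within \<open>2 q\<close> of one of its centres.
\<close>

lemma maximal_disjoint_balls:
  fixes A :: "'a set"
  assumes q: "0 < q" "q < R"
  obtains S where "finite S" "S \<subseteq> A" "disjoint_family_on (\<lambda>x. cball x q) S"
    "A \<subseteq> (\<Union>x\<in>S. cball x (2 * q))"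
proof -
  define P where "P = (\<lambda>S. finite S \<and> S \<subseteq> A \<and> disjoint_family_on (\<lambda>x. cball x q) S)"
  have "card S < Suc (nat \<lfloor>C * q powr (-t)\<rfloor>)" if "P S" for S
  proof -
    have "real (card S) \<le> C * q powr (-t) * prob (nbhd A (2 * q))"
      using that card_disjoint_balls_le[of S "\<lambda>x. x" q A] q by (simp add: P_def)
    also have "\<dots> \<le> C * q powr (-t)"
      using C_pos by (intro mult_left_le) auto
    finally show ?thesis by (simp add: le_nat_floor less_Suc_eq_le)
  qed
  moreover have "P {}" by (simp add: P_def disjoint_family_on_def)
  ultimately obtain S where S: "P S" "\<And>T. P T \<Longrightarrow> card T \<le> card S"
    using ex_has_greatest_nat[of P "{}" card] by blast
  have "a \<in> (\<Union>x\<in>S. cball x (2 * q))" if a: "a \<in> A" for a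
  proof (rule ccontr)
    assume far: "a \<notin> (\<Union>x\<in>S. cball x (2 * q))"
    then have "a \<notin> S" using q(1) by force
    have "cball x q \<inter> cball a q = {}" if "x \<in> S" for x
    proof (rule ccontr)
      assume "cball x q \<inter> cball a q \<noteq> {}"
      then obtain z where "dist x z \<le> q" "dist a z \<le> q" by auto
      then have "dist x a \<le> 2 * q" using dist_triangle2[of x a z] by simp
      then show False using far that by auto
    qed
    then have "P (insert a S)"
      using S(1) a \<open>a \<notin> S\<close> by (auto simp: P_def disjoint_family_on_insert)
    then show False using S(2)[of "insert a S"] \<open>a \<notin> S\<close> S(1) by (simp add: P_def)
  qed
  then show thesis using that S(1) unfolding P_def by blast
qed

text \<open>
  A finite premeasure bounds the number of disjoint balls of radius \<open>q\<close> by a multiple of \<open>q\<^bsup>-s\<^esup>\<close>, and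
  enlarging the balls of a maximal family to radius \<open>4 q\<close> covers the neighbourhood.
\<close>

lemma nbhd_volume_le_if_finite_premeasure:
  assumes "packing_premeasure s A < \<infinity>"
  obtains K \<delta> where "0 < \<delta>"
    "\<And>q. 0 < q \<Longrightarrow> q < \<delta> \<Longrightarrow> prob (nbhd A (2 * q)) \<le> K * q powr (t - s)"
proof -
  let ?M = "\<lambda>\<delta>. SUP D\<in>packings \<delta> A. \<Sum>(x, q)\<in>D. ennreal ((2 * q) powr s)"
  obtain \<delta> where \<delta>: "0 < \<delta>" "?M \<delta> < \<infinity>"
    using assms unfolding packing_premeasure_def INF_less_iff by blast
  define m where "m = enn2real (?M \<delta>)"
  have m: "?M \<delta> = ennreal m" 
    unfolding m_def using \<delta>(2) by (intro ennreal_enn2real[symmetric]) (simp only: infinity_ennreal_def)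
  have m_nonneg: "0 \<le> m" by (simp add: m_def)
  define K where "K = m * 2 powr (-s) * C * 4 powr t"
  show thesis
  proof
    show "0 < min \<delta> (R / 4)" using \<delta>(1) R_pos by simp
    fix q assume q0: "0 < q" "q < min \<delta> (R / 4)"
    then have q: "0 < q" "q < \<delta>" "4 * q < R" "q < R" using R_pos by auto
    obtain S where S: "finite S" "S \<subseteq> A" "disjoint_family_on (\<lambda>x. cball x q) S"
      "A \<subseteq> (\<Union>x\<in>S. cball x (2 * q))"
      using maximal_disjoint_balls[OF q(1,4)] by blast
    have "(\<lambda>x. (x, q)) ` S \<in> packings \<delta> A"
      using S(1-3) q unfolding packings_def disjoint_family_on_def by (simp add: image_subset_iff subset_iff)
    then have "(\<Sum>(x, q)\<in>(\<lambda>x. (x, q)) ` S. ennreal ((2 * q) powr s)) \<le> ennreal m"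
      unfolding m[symmetric] by (rule SUP_upper)
    also have "(\<Sum>(x, q)\<in>(\<lambda>x. (x, q)) ` S. ennreal ((2 * q) powr s)) = (\<Sum>x\<in>S. ennreal ((2 * q) powr s))"
      by (subst sum.reindex) (simp_all add: inj_on_def)
    also have "\<dots> = ennreal (real (card S) * (2 * q) powr s)"
      by (subst sum_ennreal) auto
    finally have "real (card S) * (2 * q) powr s \<le> m"
      using m_nonneg by (simp add: ennreal_le_iff)
    then have card: "real (card S) \<le> m * 2 powr (-s) * q powr (-s)"
    proof -
      have "real (card S) = real (card S) * (2 * q) powr s * (2 * q) powr (-s)"
        using q(1) by (simp add: powr_add[symmetric] mult.assoc)
      also have "\<dots> \<le> m * (2 * q) powr (-s)"
        using \<open>real (card S) * (2 * q) powr s \<le> m\<close> by (intro mult_right_mono) auto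
      finally show ?thesis using q(1) by (simp add: powr_mult mult.assoc)
    qed
    have "prob (nbhd A (2 * q)) \<le> prob (\<Union>x\<in>S. cball x (4 * q))"
    proof (rule finite_measure_mono)
      show "nbhd A (2 * q) \<subseteq> (\<Union>x\<in>S. cball x (4 * q))"
      proof
        fix z assume "z \<in> nbhd A (2 * q)"
        then obtain a where "a \<in> A" "dist a z < 2 * q" unfolding nbhd_def by auto
        moreover obtain x where x: "x \<in> S" "a \<in> cball x (2 * q)" using S(4) \<open>a \<in> A\<close> by blast
        ultimately have "z \<in> cball x (4 * q)"
          using dist_triangle[of x z a] by simp
        then show "z \<in> (\<Union>x\<in>S. cball x (4 * q))" using x(1) by blast
      qed
      show "(\<Union>x\<in>S. cball x (4 * q)) \<in> sets \<mu>"
        using S(1) by (intro sets.finite_UN) (auto simp: sets_borel)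
    qed
    also have "\<dots> \<le> (\<Sum>x\<in>S. prob (cball x (4 * q)))"
      using S(1) by (intro finite_measure_subadditive_finite) (auto simp: sets_borel)
    also have "\<dots> \<le> real (card S) * (C * (4 * q) powr t)"
      using cball_upper[of "4 * q"] q by (intro sum_bounded_above) auto
    also have "\<dots> \<le> (m * 2 powr (-s) * q powr (-s)) * (C * (4 * q) powr t)"
      using card C_pos by (intro mult_right_mono) auto
    also have "\<dots> = K * q powr (t - s)"
    proof -
      have "q powr (t - s) = q powr t * q powr (-s)" by (simp add: powr_add[symmetric])
      then show ?thesis using q(1) by (simp add: K_def powr_mult mult_ac)
    qed
    finally show "prob (nbhd A (2 * q)) \<le> K * q powr (t - s)" .
  qed
qed

lemma card_disjoint_balls_le_powr:
  fixes c :: "'i \<Rightarrow> 'a"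
  assumes I: "finite I" "disjoint_family_on (\<lambda>i. cball (c i) q) I" "c ` I \<subseteq> A"
    and q: "0 < q" "q < R" and small: "prob (nbhd A (2 * q)) \<le> q powr (t - s)"
  shows "real (card I) \<le> C * q powr (-s)"
proof -
  have "real (card I) \<le> C * q powr (-t) * prob (nbhd A (2 * q))"
    by (rule card_disjoint_balls_le[OF I q])
  also have "\<dots> \<le> C * q powr (-t) * q powr (t - s)"
    using small C_pos by (intro mult_left_mono) auto
  also have "\<dots> = C * q powr (-s)"
    unfolding mult.assoc powr_add[symmetric] by simp
  finally show ?thesis .
qed

text \<open>
  If the volume were small at arbitrarily small scales \<open>q\<close>, then \<open>A\<close> would be covered there by at most
  \<open>C q\<^bsup>-u\<^esup>\<close> balls of radius \<open>2 q\<close>, at a total cost of order \<open>q\<^bsup>s-u\<^esup>\<close>.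
\<close>

lemma nbhd_volume_gt_if_hausdorff_pos:
  assumes s: "0 < s" "u < s" and pos: "hausdorff_measure s A \<noteq> 0"
  shows "\<exists>\<delta>>0. \<forall>q. 0 < q \<and> q < \<delta> \<longrightarrow> q powr (t - u) < prob (nbhd A (2 * q))"
proof (rule ccontr)
  assume contra: "\<not> ?thesis"
  have small: "\<exists>q. 0 < q \<and> q < \<delta> \<and> prob (nbhd A (2 * q)) \<le> q powr (t - u)" if "0 < \<delta>" for \<delta>
  proof (rule ccontr)
    assume "\<not> ?thesis"
    then have "\<forall>q. 0 < q \<and> q < \<delta> \<longrightarrow> q powr (t - u) < prob (nbhd A (2 * q))"
      unfolding not_ex de_Morgan_conj not_le by blast
    then show False using contra that by blast
  qed
  have "hausdorff_content s \<eta> A \<le> 0 + ennreal e" if \<eta>: "0 < \<eta>" and e: "0 < e" for \<eta> e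
  proof -
    \<comment> \<open>the scale at which the cost \<open>C * 4 powr s * \<epsilon> powr (s - u)\<close> equals \<open>e\<close>\<close>
    define \<epsilon> where "\<epsilon> = (e / (C * 4 powr s)) powr (1 / (s - u))"
    have "0 < min \<epsilon> (min R (\<eta> / 4))" using e \<eta> C_pos R_pos by (simp add: \<epsilon>_def)
    from small[OF this] obtain q where q0: "0 < q" "q < min \<epsilon> (min R (\<eta> / 4))"
      and vol: "prob (nbhd A (2 * q)) \<le> q powr (t - u)" by blast
    then have q: "0 < q" "q < \<epsilon>" "q < R" "q < \<eta> / 4" by auto
    obtain S where S: "finite S" "S \<subseteq> A" "disjoint_family_on (\<lambda>x. cball x q) S"
      "A \<subseteq> (\<Union>x\<in>S. cball x (2 * q))"
      using maximal_disjoint_balls[OF q(1,3)] by blast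
    obtain h where h: "bij_betw h {0..<card S} S"
      using ex_bij_betw_nat_finite[OF S(1)] by blast
    define U where "U = (\<lambda>i. if i < card S then cball (h i) (2 * q) else {})"
    have diam: "bounded (U i) \<and> diameter (U i) \<le> 4 * q" for i
    proof
      show "bounded (U i)" by (simp add: U_def)
      show "diameter (U i) \<le> 4 * q"
      proof (cases "U i = {}")
        case True
        then show ?thesis using q(1) by (simp add: diameter_def)
      next
        case False
        have "dist x y \<le> 4 * q" if "x \<in> U i" "y \<in> U i" for x y
          using that dist_triangle3[of x y "h i"] by (simp add: U_def split: if_splits)
        then show ?thesis
          using False unfolding diameter_def by (auto intro!: cSUP_least)
      qed
    qed
    have "A \<subseteq> (\<Union>i. U i)"
    proof
      fix a assume "a \<in> A"
      then obtain x where "x \<in> S" "a \<in> cball x (2 * q)" using S(4) by blast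
      moreover from \<open>x \<in> S\<close> h obtain i where "i \<in> {0..<card S}" "x = h i"
        unfolding bij_betw_def by blast
      ultimately have "a \<in> U i" by (simp add: U_def)
      then show "a \<in> (\<Union>i. U i)" by blast
    qed
    then have "hausdorff_content s \<eta> A \<le> (\<Sum>i. ennreal (diameter (U i) powr s))"
      unfolding hausdorff_content_def using diam q(4)
      by (intro INF_lower) (fastforce intro: order_trans)
    also have "\<dots> = (\<Sum>i<card S. ennreal (diameter (U i) powr s))"
      using s(1) by (intro suminf_finite) (auto simp: U_def)
    also have "\<dots> \<le> (\<Sum>i<card S. ennreal ((4 * q) powr s))"
    proof (intro sum_mono ennreal_leI powr_mono2)
      show "0 \<le> diameter (U i)" for i using diam by (auto intro: diameter_ge_0)
    qed (use diam s in auto)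
    also have "\<dots> = ennreal (real (card S) * (4 * q) powr s)"
      by (subst sum_ennreal) auto
    also have "\<dots> \<le> ennreal ((C * q powr (-u)) * (4 * q) powr s)"
      using card_disjoint_balls_le_powr[of S "\<lambda>x. x", OF S(1,3) _ q(1,3) vol] S(2)
      by (intro ennreal_leI mult_right_mono) auto
    also have "(C * q powr (-u)) * (4 * q) powr s = C * 4 powr s * q powr (s - u)"
    proof -
      have "q powr (s - u) = q powr s * q powr (-u)" by (simp add: powr_add[symmetric])
      then show ?thesis using q(1) by (simp add: powr_mult mult_ac)
    qed
    also have "\<dots> \<le> C * 4 powr s * \<epsilon> powr (s - u)"
      using q s C_pos by (intro mult_left_mono powr_mono2) auto
    also have "\<dots> = e"
      using s e C_pos by (simp add: \<epsilon>_def powr_powr)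
    finally show ?thesis by (simp add: ennreal_leI)
  qed
  then have "hausdorff_content s \<eta> A = 0" if "0 < \<eta>" for \<eta>
    using ennreal_le_epsilon[of 0 "hausdorff_content s \<eta> A"] that by simp
  then show False using pos by (simp add: hausdorff_measure_eq_0_iff)
qed

text \<open>
  A packing may mix radii, so its members are sorted into dyadic levels. At level \<open>k\<close> all balls can be
  shrunk to the common radius \<open>2\<^bsup>-(k+1)\<^esup>\<close> and counted by volume; the levels contribute terms of a
  geometric series with ratio \<open>\<theta>\<close>, beginning at level \<open>n\<close> because the radii are at most \<open>2\<^bsup>-n\<^esup>\<close>.
\<close>

lemma packing_sum_le:
  assumes s: "0 < s" "u < s" and small: "(1 / 2) ^ n < \<delta>" "\<delta> \<le> R"
    and vol: "\<And>q. 0 < q \<Longrightarrow> q < \<delta> \<Longrightarrow> prob (nbhd A (2 * q)) \<le> q powr (t - u)"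
    and D: "D \<in> packings ((1 / 2) ^ n) A"
  defines "\<theta> \<equiv> 2 powr (u - s)"
  shows "(\<Sum>(x, q)\<in>D. (2 * q) powr s) \<le> C * 4 powr s * (\<theta> ^ n / (1 - \<theta>))"
proof -
  have fin: "finite D" and cen: "\<And>x q. (x, q) \<in> D \<Longrightarrow> x \<in> A \<and> 0 < q \<and> q \<le> (1 / 2) ^ n"
    and disj: "disjoint_family_on (\<lambda>(x, q). cball x q) D"
    using D unfolding packings_def by auto
  have \<theta>: "0 < \<theta>" "\<theta> < 1"
    using s(2) powr_less_mono[of "u - s" 0 "2 :: real"] by (simp_all add: \<theta>_def)
  define lev where "lev = (\<lambda>d :: 'a \<times> real. nat \<lfloor>- log 2 (snd d)\<rfloor>)"
  have lev: "(1 / 2) ^ Suc (lev d) < snd d" "snd d \<le> (1 / 2) ^ lev d" "n \<le> lev d" if "d \<in> D" for d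
  proof -
    have q: "0 < snd d" "snd d \<le> (1 / 2) ^ n" using cen[of "fst d" "snd d"] that by auto
    have powr_half: "(1 / 2) ^ m = 2 powr (- real m)" for m :: nat
      by (simp add: powr_minus powr_realpow power_one_over inverse_eq_divide)
    have "log 2 (snd d) \<le> - real n"
      using q by (simp add: powr_half log_le_iff)
    then have n: "real n \<le> - log 2 (snd d)" by simp
    then show "n \<le> lev d" unfolding lev_def by (simp add: le_nat_floor)
    have l: "real (lev d) \<le> - log 2 (snd d)" "- log 2 (snd d) < real (lev d) + 1"
      using n unfolding lev_def by linarith+
    show "snd d \<le> (1 / 2) ^ lev d"
      using l(1) q(1) by (simp add: powr_half log_le_iff[symmetric])
    show "(1 / 2) ^ Suc (lev d) < snd d"
      using l(2) q(1) unfolding powr_half by (simp add: less_log_iff[symmetric])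
  qed
  have level_sum: "(\<Sum>d\<in>{d \<in> D. lev d = k}. (2 * snd d) powr s) \<le> C * 4 powr s * \<theta> ^ k"
    if k: "n \<le> k" for k
  proof -
    define p where "p = (1 / 2 :: real) ^ Suc k"
    have "(1 / 2 :: real) ^ Suc k \<le> (1 / 2) ^ n" using k by (intro power_decreasing) auto
    then have p: "0 < p" "p < \<delta>" "p < R" using small by (auto simp: p_def)
    have "real (card {d \<in> D. lev d = k}) \<le> C * p powr (-u)"
    proof (rule card_disjoint_balls_le_powr[where c = fst])
      show "disjoint_family_on (\<lambda>d. cball (fst d) p) {d \<in> D. lev d = k}"
        unfolding disjoint_family_on_def
      proof (intro ballI impI)
        fix d e assume de: "d \<in> {d \<in> D. lev d = k}" "e \<in> {d \<in> D. lev d = k}" "d \<noteq> e"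
        then have "p < snd d" "p < snd e" using lev(1)[of d] lev(1)[of e] by (simp_all add: p_def)
        moreover have "cball (fst d) (snd d) \<inter> cball (fst e) (snd e) = {}"
          using disjoint_family_onD[OF disj, of d e] de by (simp add: case_prod_beta)
        moreover have "cball (fst d) p \<subseteq> cball (fst d) (snd d)" "cball (fst e) p \<subseteq> cball (fst e) (snd e)"
          using calculation by (auto intro: subset_cball less_imp_le)
        ultimately show "cball (fst d) p \<inter> cball (fst e) p = {}" by blast
      qed
      show "fst ` {d \<in> D. lev d = k} \<subseteq> A" using cen by auto
    qed (use fin p vol in auto)
    moreover have "(2 * snd d) powr s \<le> (4 * p) powr s" if "d \<in> {d \<in> D. lev d = k}" for d
      using that lev(2)[of d] cen[of "fst d" "snd d"] s(1)
      by (intro powr_mono2) (auto simp: p_def)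
    ultimately have "(\<Sum>d\<in>{d \<in> D. lev d = k}. (2 * snd d) powr s) \<le> (C * p powr (-u)) * (4 * p) powr s"
      using sum_bounded_above[of "{d \<in> D. lev d = k}" "\<lambda>d. (2 * snd d) powr s" "(4 * p) powr s"]
        mult_right_mono[of "real (card {d \<in> D. lev d = k})" "C * p powr (-u)" "(4 * p) powr s"]
      by (simp del: mult_le_cancel_right)
    also have "\<dots> = C * 4 powr s * p powr (s - u)"
    proof -
      have "p powr (s - u) = p powr s * p powr (-u)" by (simp add: powr_add[symmetric])
      then show ?thesis using p(1) by (simp add: powr_mult mult_ac)
    qed
    also have "p powr (s - u) = \<theta> ^ Suc k"
    proof -
      have "p = 2 powr (- real (Suc k))"
        unfolding p_def by (simp add: powr_minus powr_realpow power_one_over inverse_eq_divide del: power_Suc of_nat_Suc)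
      then have "p powr (s - u) = \<theta> powr (real (Suc k))"
        unfolding \<theta>_def by (simp add: powr_powr algebra_simps)
      then show ?thesis using \<theta>(1) by (simp add: powr_realpow del: power_Suc of_nat_Suc)
    qed
    also have "C * 4 powr s * \<theta> ^ Suc k \<le> C * 4 powr s * \<theta> ^ k"
      using C_pos \<theta> by (intro mult_left_mono power_decreasing) auto
    finally show ?thesis .
  qed
  obtain m where m: "lev ` D \<subseteq> {n..<n + m}"
  proof -
    obtain M where "\<And>j. j \<in> lev ` D \<Longrightarrow> j < M"
      using finite_nat_set_iff_bounded fin finite_imageI by metis
    then have "lev ` D \<subseteq> {n..<n + M}" using lev(3) by fastforce
    then show thesis by (rule that)
  qed
  have "(\<Sum>(x, q)\<in>D. (2 * q) powr s) = (\<Sum>d\<in>D. (2 * snd d) powr s)"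
    by (simp add: case_prod_beta)
  also have "\<dots> = (\<Sum>k\<in>{n..<n + m}. \<Sum>d\<in>{d \<in> D. lev d = k}. (2 * snd d) powr s)"
    using fin m by (intro sum.group[symmetric]) auto
  also have "\<dots> \<le> (\<Sum>k\<in>{n..<n + m}. C * 4 powr s * \<theta> ^ k)"
    using level_sum by (intro sum_mono) auto
  also have "\<dots> = C * 4 powr s * (\<theta> ^ n * (\<Sum>k<m. \<theta> ^ k))"
  proof -
    have "(\<Sum>k\<in>{n..<n + m}. \<theta> ^ k) = (\<Sum>k<m. \<theta> ^ (k + n))"
      using sum.shift_bounds_nat_ivl[of "\<lambda>k. \<theta> ^ k" 0 n m] by (simp add: lessThan_atLeast0 add.commute)
    also have "\<dots> = \<theta> ^ n * (\<Sum>k<m. \<theta> ^ k)"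
      by (simp add: sum_distrib_left power_add mult.commute)
    finally show ?thesis by (simp add: sum_distrib_left[symmetric])
  qed
  also have "\<dots> \<le> C * 4 powr s * (\<theta> ^ n * (1 / (1 - \<theta>)))"
  proof -
    have "(\<Sum>k<m. \<theta> ^ k) \<le> (\<Sum>k. \<theta> ^ k)"
      using \<theta> by (intro sum_le_suminf summable_geometric) auto
    also have "\<dots> = 1 / (1 - \<theta>)" using \<theta> by (intro suminf_geometric) auto
    finally show ?thesis using C_pos \<theta> by (intro mult_left_mono) auto
  qed
  finally show ?thesis by simp
qed

text \<open>
  In contrast to Hausdorff measure, small volume is now assumed at all small scales, as
  a packing may use all of them; this is why only arbitrarily small good scales are obtained.
\<close>

lemma nbhd_volume_gt_if_packing_pos:
  assumes s: "0 < s" "u < s" and pos: "packing_measure s A \<noteq> 0" and \<delta>: "0 < \<delta>"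
  shows "\<exists>q. 0 < q \<and> q < \<delta> \<and> q powr (t - u) < prob (nbhd A (2 * q))"
proof (rule ccontr)
  assume contra: "\<not> ?thesis"
  define \<theta> where "\<theta> = 2 powr (u - s)"
  have \<theta>: "0 < \<theta>" "\<theta> < 1"
    using s(2) powr_less_mono[of "u - s" 0 "2 :: real"] by (simp_all add: \<theta>_def)
  define \<eta> where "\<eta> = min \<delta> R"
  have \<eta>: "0 < \<eta>" "\<eta> \<le> R" using \<delta> R_pos by (auto simp: \<eta>_def)
  have vol: "prob (nbhd A (2 * q)) \<le> q powr (t - u)" if "0 < q" "q < \<eta>" for q
  proof (rule ccontr)
    assume "\<not> ?thesis"
    then show False using contra that unfolding \<eta>_def not_le by auto
  qed
  obtain n0 where n0: "(1 / 2) ^ n0 < \<eta>" using real_arch_pow_inv[OF \<eta>(1), of "1 / 2"] by auto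
  have le: "packing_premeasure s A \<le> ennreal (C * 4 powr s * (\<theta> ^ n / (1 - \<theta>)))" if "n0 \<le> n" for n
  proof -
    have "(1 / 2 :: real) ^ n \<le> (1 / 2) ^ n0" using that by (intro power_decreasing) auto
    from this n0 have n: "(1 / 2) ^ n < \<eta>" by (rule le_less_trans)
    have "packing_premeasure s A \<le> (SUP D\<in>packings ((1 / 2) ^ n) A. \<Sum>(x, q)\<in>D. ennreal ((2 * q) powr s))"
      unfolding packing_premeasure_def by (rule INF_lower) simp
    also have "\<dots> \<le> ennreal (C * 4 powr s * (\<theta> ^ n / (1 - \<theta>)))"
    proof (rule SUP_least)
      fix D assume D: "D \<in> packings ((1 / 2) ^ n) A"
      have "(\<Sum>(x, q)\<in>D. ennreal ((2 * q) powr s)) = ennreal (\<Sum>(x, q)\<in>D. (2 * q) powr s)"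
        by (simp add: case_prod_beta sum_ennreal)
      also have "\<dots> \<le> ennreal (C * 4 powr s * (\<theta> ^ n / (1 - \<theta>)))"
        using packing_sum_le[OF s n \<eta>(2) vol D] unfolding \<theta>_def by (rule ennreal_leI)
      finally show "(\<Sum>(x, q)\<in>D. ennreal ((2 * q) powr s)) \<le> ennreal (C * 4 powr s * (\<theta> ^ n / (1 - \<theta>)))" .
    qed
    finally show ?thesis .
  qed
  have "(\<lambda>n. C * 4 powr s * (\<theta> ^ n / (1 - \<theta>))) \<longlonglongrightarrow> C * 4 powr s * (0 / (1 - \<theta>))"
    using \<theta> by (intro tendsto_intros LIMSEQ_power_zero) auto
  then have "(\<lambda>n. ennreal (C * 4 powr s * (\<theta> ^ n / (1 - \<theta>)))) \<longlonglongrightarrow> ennreal 0"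
    by (intro tendsto_ennrealI) simp
  then have "packing_premeasure s A \<le> ennreal 0"
    using le by (intro LIMSEQ_le_const) auto
  then show False
    using packing_measure_le_premeasure[of s A] pos by simp
qed

end

section \<open>Divergence and convergence along the radii\<close>

text \<open>
  For decreasing terms, a single term that is large compared with \<open>1 / n\<close> already contributes to a large
  partial sum. This turns information about one radius, as given by an upper limit, into a
  statement about the series.
\<close>

lemma Suc_times_le_suminf_if_decseq:
  fixes f :: "nat \<Rightarrow> real"
  assumes "decseq f" "\<And>n. 0 \<le> f n" "summable f"
  shows "real (Suc n) * f n \<le> suminf f"
proof -
  have "real (Suc n) * f n \<le> (\<Sum>m<Suc n. f m)"
    using sum_bounded_below[of "{..<Suc n}" "f n" f] decseqD[OF assms(1)]
    by (simp del: of_nat_Suc sum.lessThan_Suc add: less_Suc_eq_le)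
  also have "\<dots> \<le> suminf f"
    using assms by (intro sum_le_suminf) auto
  finally show ?thesis .
qed

lemma eventually_Suc_powr_gt:
  assumes c: "0 < c"
  shows "\<forall>\<^sub>F n in sequentially. K < real (Suc n) powr c"
proof -
  define N where "N = nat \<lceil>(\<bar>K\<bar> + 1) powr (1 / c)\<rceil>"
  have "K < real (Suc n) powr c" if "N \<le> n" for n
  proof -
    have "K < \<bar>K\<bar> + 1" by simp
    also have "\<bar>K\<bar> + 1 = ((\<bar>K\<bar> + 1) powr (1 / c)) powr c" using c by (simp add: powr_powr)
    also have "\<dots> \<le> real (Suc n) powr c"
    proof (rule powr_mono2)
      have "(\<bar>K\<bar> + 1) powr (1 / c) \<le> real N" unfolding N_def by (rule real_nat_ceiling_ge)
      then show "(\<bar>K\<bar> + 1) powr (1 / c) \<le> real (Suc n)" using that by simp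
    qed (use c in auto)
    finally show ?thesis .
  qed
  then show ?thesis unfolding eventually_sequentially by blast
qed

text \<open>
  A volume bounded by \<open>1\<close> cannot exceed \<open>q\<^sup>u\<close> for \<open>q < 1\<close> unless \<open>u\<close> is positive. For
  \<open>u = t - s\<close> this reflects that no set has dimension larger than \<open>t\<close>.
\<close>

lemma exponent_pos_if_volume_gt:
  fixes f :: "real \<Rightarrow> real"
  assumes le1: "\<And>q. f q \<le> 1"
    and large: "\<And>\<delta>. 0 < \<delta> \<Longrightarrow> \<exists>q. 0 < q \<and> q < \<delta> \<and> q powr u < f (2 * q)"
  shows "0 < u"
proof (rule ccontr)
  assume "\<not> 0 < u"
  obtain q where q: "0 < q" "q < 1" "q powr u < f (2 * q)" using large[of 1] by auto
  have "q powr 0 \<le> q powr u" using \<open>\<not> 0 < u\<close> q by (intro powr_mono') auto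
  then show False using q le1[of "2 * q"] by simp
qed

text \<open>
  For \<open>\<beta>\<close> between \<open>u\<close> and the critical exponent there are arbitrarily large \<open>n\<close> with
  \<open>r\<^sub>n > (n + 1)\<^bsup>-1/\<beta>\<^esup>\<close>, for which \<open>(n + 1) f(r\<^sub>n)\<close> is at least of order \<open>(n + 1)\<^bsup>1 - u/\<beta>\<^esup>\<close> and hence
  not bounded by the sum of a convergent series.
\<close>

lemma not_summable_if_volume_gt:
  fixes f :: "real \<Rightarrow> real" and r :: "nat \<Rightarrow> real"
  assumes mono: "\<And>p q. p \<le> q \<Longrightarrow> f p \<le> f q" and nonneg: "\<And>q. 0 \<le> f q" and le1: "\<And>q. f q \<le> 1"
    and \<delta>: "0 < \<delta>" and large: "\<And>q. 0 < q \<Longrightarrow> q < \<delta> \<Longrightarrow> q powr u < f (2 * q)"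
    and r: "\<And>n. 0 < r n" "decseq r" "r \<longlonglongrightarrow> 0"
    and u: "ereal u < critical_exponent t r"
  shows "\<not> summable (\<lambda>n. f (r n))"
proof
  assume sum: "summable (\<lambda>n. f (r n))"
  have u_pos: "0 < u"
  proof (rule exponent_pos_if_volume_gt[of f])
    fix \<epsilon> :: real assume "0 < \<epsilon>"
    then show "\<exists>q. 0 < q \<and> q < \<epsilon> \<and> q powr u < f (2 * q)"
      using \<delta> large[of "min \<epsilon> \<delta> / 2"] by (intro exI[of _ "min \<epsilon> \<delta> / 2"]) auto
  qed (rule le1)
  obtain \<beta> where \<beta>: "ereal u < ereal \<beta>" "ereal \<beta> < critical_exponent t r"
    using ereal_dense2[OF u] by blast
  then have \<beta>u: "u < \<beta>" by simp
  have freq: "\<exists>\<^sub>F n in sequentially. ereal \<beta> < ereal (ln (real (Suc n)) / - ln (r n))"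
  proof (rule ccontr)
    assume "\<not> ?thesis"
    then have "limsup (\<lambda>n. ereal (ln (real (Suc n)) / - ln (r n))) \<le> ereal \<beta>"
      by (intro Limsup_bounded) (simp only: not_frequently not_less)
    then show False using \<beta>(2) unfolding critical_exponent_def by auto
  qed
  define S where "S = suminf (\<lambda>n. f (r n))"
  have "\<forall>\<^sub>F n in sequentially. r n < min 1 (2 * \<delta>)"
    using order_tendstoD(2)[OF r(3), of "min 1 (2 * \<delta>)"] \<delta> by simp
  moreover have "\<forall>\<^sub>F n in sequentially. S * 2 powr u < real (Suc n) powr (1 - u / \<beta>)"
    using u_pos \<beta>u by (intro eventually_Suc_powr_gt) simp
  ultimately have "\<forall>\<^sub>F n in sequentially. r n < min 1 (2 * \<delta>) \<and>
      S * 2 powr u < real (Suc n) powr (1 - u / \<beta>)" by (rule eventually_conj)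
  from frequently_eventually_frequently[OF freq this] obtain n
    where n: "\<beta> < ln (real (Suc n)) / - ln (r n)" "r n < 1" "r n < 2 * \<delta>"
      "S * 2 powr u < real (Suc n) powr (1 - u / \<beta>)"
    using frequently_ex by fastforce
  have neg: "ln (r n) < 0" using r(1)[of n] n(2) by simp
  have "\<beta> * - ln (r n) < ln (real (Suc n))"
    using n(1) neg pos_less_divide_eq[of "- ln (r n)"] by (simp only: neg_0_less_iff_less)
  then have "- (1 / \<beta>) * ln (real (Suc n)) \<le> ln (r n)"
    using \<beta>u u_pos by (simp add: field_simps)
  then have "exp (u * (- (1 / \<beta>) * ln (real (Suc n)))) \<le> exp (u * ln (r n))"
    using u_pos by (subst exp_le_cancel_iff) (rule mult_left_mono, auto)
  then have rad: "real (Suc n) powr (- u / \<beta>) \<le> r n powr u"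
    using r(1)[of n] by (simp add: powr_def del: of_nat_Suc)
  have "real (Suc n) powr (1 - u / \<beta>) = real (Suc n) * real (Suc n) powr (- u / \<beta>)"
    by (simp add: powr_diff powr_minus_divide del: of_nat_Suc)
  also have "\<dots> \<le> real (Suc n) * r n powr u"
    using rad by (intro mult_left_mono) auto
  also have "\<dots> = real (Suc n) * (r n / 2) powr u * 2 powr u"
    using r(1)[of n] by (simp add: powr_divide)
  also have "\<dots> \<le> real (Suc n) * f (r n) * 2 powr u"
    using large[of "r n / 2"] r(1)[of n] n(3) by (intro mult_right_mono mult_left_mono) auto
  also have "\<dots> \<le> S * 2 powr u"
    unfolding S_def using mono nonneg sum decseqD[OF r(2)]
    by (intro mult_right_mono Suc_times_le_suminf_if_decseq) (auto simp: decseq_def)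
  finally show False using n(4) by simp
qed

text \<open>
  Given a good scale \<open>q\<close>, let \<open>i\<close> be the last index with \<open>2 q < 2\<^bsup>-(k\<^sub>i+1)\<^esup>\<close>, so that the radii of
  dyadic level \<open>k\<^sub>i\<close> all exceed \<open>2 q\<close>. There are at least \<open>2\<^bsup>\<beta>k\<^sub>i\<^esup>\<close> of them, and each contributes at least \<open>f(2q) > q\<^sup>u\<close>. As
  the next level \<open>k\<^bsub>i+1\<^esub>\<close> is too fine, \<open>q\<close> is at least \<open>2\<^bsup>-(k\<^bsub>i+1\<^esub> + 2)\<^esup>\<close>, so \<open>q\<^sup>u\<close> is at least
  \<open>2\<^bsup>-\<gamma>k\<^sub>i\<^esup>\<close> with \<open>\<gamma> < \<beta>\<close>, because consecutive levels are asymptotically equal.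
\<close>

lemma not_summable_if_volume_gt_frequently:
  fixes f :: "real \<Rightarrow> real" and r :: "nat \<Rightarrow> real" and k :: "nat \<Rightarrow> nat"
  assumes mono: "\<And>p q. p \<le> q \<Longrightarrow> f p \<le> f q" and nonneg: "\<And>q. 0 \<le> f q" and le1: "\<And>q. f q \<le> 1"
    and large: "\<And>\<delta>. 0 < \<delta> \<Longrightarrow> \<exists>q. 0 < q \<and> q < \<delta> \<and> q powr u < f (2 * q)"
    and u: "u < a"
    and k: "strict_mono k" "\<And>i. 0 < k i" "(\<lambda>i. real (k (Suc i)) / real (k i)) \<longlonglongrightarrow> 1"
    and count: "(\<lambda>i. log2_nat (scale_count r (k i)) / ereal (real (k i))) \<longlonglongrightarrow> ereal a"
  shows "\<not> summable (\<lambda>n. f (r n))"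
proof
  assume sum: "summable (\<lambda>n. f (r n))"
  define S where "S = suminf (\<lambda>n. f (r n))"
  have u_pos: "0 < u" using exponent_pos_if_volume_gt[of f u] le1 large by blast
  \<comment> \<open>room for the two asymptotic hypotheses: \<open>\<beta>\<close> for the number of radii, \<open>\<gamma>\<close> for the gaps\<close>
  define \<beta> where "\<beta> = (u + a) / 2"
  define \<gamma> where "\<gamma> = (u + \<beta>) / 2"
  have order: "u < \<gamma>" "\<gamma> < \<beta>" "\<beta> < a" using u by (simp_all add: \<beta>_def \<gamma>_def)
  have k_ge: "i \<le> k i" for i using strict_mono_imp_increasing[OF k(1)] .
  have k_inf: "filterlim (\<lambda>i. real (k i)) at_top sequentially"
    using filterlim_compose[OF filterlim_real_sequentially filterlim_subseq[OF k(1)]] by simp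
  have E1: "\<forall>\<^sub>F i in sequentially. ereal \<beta> < log2_nat (scale_count r (k i)) / ereal (real (k i))"
    using order_tendstoD(1)[OF count] order by simp
  have "(\<lambda>i. u * (real (k (Suc i)) / real (k i) + 2 / real (k i))) \<longlonglongrightarrow> u * (1 + 0)"
    by (intro tendsto_intros k(3) tendsto_divide_0[OF tendsto_const] filterlim_at_top_imp_at_infinity k_inf)
  then have E2: "\<forall>\<^sub>F i in sequentially. u * (real (k (Suc i)) / real (k i) + 2 / real (k i)) < \<gamma>"
    by (rule order_tendstoD(2)) (use order in simp)
  have E3: "\<forall>\<^sub>F i in sequentially. S / ((\<beta> - \<gamma>) * ln 2) < real (k i)"
    using k_inf unfolding filterlim_at_top_dense by blast
  obtain I where I: "\<And>i. I \<le> i \<Longrightarrow> ereal \<beta> < log2_nat (scale_count r (k i)) / ereal (real (k i)) \<and>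
      u * (real (k (Suc i)) / real (k i) + 2 / real (k i)) < \<gamma> \<and> S / ((\<beta> - \<gamma>) * ln 2) < real (k i)"
    using eventually_conj[OF E1 eventually_conj[OF E2 E3]] unfolding eventually_sequentially by blast
  obtain q where q: "0 < q" "q < (1 / 2) ^ (k I + 2)" "q powr u < f (2 * q)"
    using large[of "(1 / 2) ^ (k I + 2)"] by auto
  obtain j0 where j0: "(1 / 2) ^ j0 < q" using real_arch_pow_inv[OF q(1), of "1 / 2"] by auto
  have ex: "(1 / 2) ^ (k j0 + 2) \<le> q"
  proof -
    have "(1 / 2 :: real) ^ (k j0 + 2) \<le> (1 / 2) ^ j0"
      using k_ge[of j0] by (intro power_decreasing) auto
    then show ?thesis using j0 by simp
  qed
  define j where "j = (LEAST j. (1 / 2) ^ (k j + 2) \<le> q)"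
  have j: "(1 / 2) ^ (k j + 2) \<le> q" unfolding j_def using ex by (rule LeastI)
  have "I < j"
  proof (rule ccontr)
    assume "\<not> I < j"
    then have "k j \<le> k I" using strict_mono_less_eq[OF k(1)] by simp
    then have "(1 / 2 :: real) ^ (k I + 2) \<le> (1 / 2) ^ (k j + 2)" by (intro power_decreasing) auto
    then show False using j q(2) by (meson leD order_trans)
  qed
  then obtain i where i: "j = Suc i" "I \<le> i" by (cases j) auto
  have "\<not> (1 / 2) ^ (k i + 2) \<le> q"
    using not_less_Least[of i "\<lambda>j. (1 / 2) ^ (k j + 2) \<le> q"] i(1) unfolding j_def[symmetric] by simp
  then have q_small: "2 * q \<le> 1 / 2 ^ (k i + 1)"
    by (simp add: power_one_over field_simps)
  define T where "T = {n. 1 / 2 ^ (k i + 1) \<le> r n \<and> r n < 1 / 2 ^ k i}"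
  have cardT: "card T = scale_count r (k i)" unfolding T_def scale_count_def ..
  have "ereal \<beta> < log2_nat (card T) / ereal (real (k i))" using I[OF i(2)] cardT by simp
  then have "card T \<noteq> 0" and logT: "\<beta> < log 2 (real (card T)) / real (k i)"
    using k(2)[of i] by (auto simp: log2_nat_def split: if_splits)
  then have finT: "finite T" using card_ge_0_finite by blast
  have "\<beta> * real (k i) < log 2 (real (card T))"
    using logT k(2)[of i] by (simp add: less_divide_eq)
  then have T_ge: "2 powr (\<beta> * real (k i)) \<le> real (card T)"
    using \<open>card T \<noteq> 0\<close> by (simp add: le_log_iff[symmetric])
  have gap: "u * (real (k j) + 2) \<le> \<gamma> * real (k i)"
  proof -
    have "u * (real (k j) / real (k i) + 2 / real (k i)) < \<gamma>" using I[OF i(2)] i(1) by blast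
    then show ?thesis using k(2)[of i] by (simp add: field_simps)
  qed
  have f_ge: "2 powr (- \<gamma> * real (k i)) \<le> f (2 * q)"
  proof -
    have "2 powr (- \<gamma> * real (k i)) \<le> 2 powr (- u * (real (k j) + 2))"
      using gap by (intro powr_mono) auto
    also have "\<dots> = ((1 / 2) ^ (k j + 2)) powr u"
    proof -
      have "(1 / 2 :: real) ^ (k j + 2) = 2 powr (- real (k j + 2))"
        unfolding powr_minus powr_realpow[OF zero_less_numeral] by (simp add: power_one_over inverse_eq_divide)
      then show ?thesis by (simp add: powr_powr algebra_simps)
    qed
    also have "\<dots> \<le> q powr u"
      using j u_pos by (intro powr_mono2) auto
    finally show ?thesis using q(3) by simp
  qed
  have "2 powr ((\<beta> - \<gamma>) * real (k i)) = 2 powr (\<beta> * real (k i)) * 2 powr (- \<gamma> * real (k i))"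
    by (simp add: powr_add[symmetric] algebra_simps)
  also have "\<dots> \<le> real (card T) * f (2 * q)"
    using T_ge f_ge by (intro mult_mono) auto
  also have "\<dots> \<le> (\<Sum>n\<in>T. f (r n))"
    using q_small by (intro sum_bounded_below mono) (auto simp: T_def)
  also have "\<dots> \<le> S"
    unfolding S_def using sum finT nonneg by (intro sum_le_suminf) auto
  finally have "2 powr ((\<beta> - \<gamma>) * real (k i)) \<le> S" .
  moreover have "(\<beta> - \<gamma>) * real (k i) * ln 2 \<le> 2 powr ((\<beta> - \<gamma>) * real (k i))"
  proof -
    have "2 powr ((\<beta> - \<gamma>) * real (k i)) = exp ((\<beta> - \<gamma>) * real (k i) * ln 2)"
      by (simp add: powr_def)
    then show ?thesis using exp_ge_add_one_self[of "(\<beta> - \<gamma>) * real (k i) * ln 2"] by linarith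
  qed
  moreover have "S < (\<beta> - \<gamma>) * real (k i) * ln 2"
  proof -
    have "S / ((\<beta> - \<gamma>) * ln 2) < real (k i)" using I[OF i(2)] by blast
    then show ?thesis using order by (simp add: divide_less_eq mult_ac)
  qed
  ultimately show False by linarith
qed

text \<open>
  For positive \<open>\<beta>\<close> between the critical exponent and \<open>v\<close>, eventually \<open>r\<^sub>n < (n + 1)\<^bsup>-1/\<beta>\<^esup>\<close>, and \<open>v / \<beta> > 1\<close>. The
  condition \<open>v < t\<close> ensures that the minimum defining the critical exponent is the upper limit.
\<close>

lemma summable_radii_powr:
  assumes r: "\<And>n. 0 < r n" "r \<longlonglongrightarrow> 0"
    and v: "0 < v" "v < t" "critical_exponent t r < ereal v"
  shows "summable (\<lambda>n. r n powr v)"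
proof -
  have L: "limsup (\<lambda>n. ereal (ln (real (Suc n)) / - ln (r n))) < ereal v"
    using v(2,3) unfolding critical_exponent_def min_def
    by (auto split: if_splits)
  have "max 0 (limsup (\<lambda>n. ereal (ln (real (Suc n)) / - ln (r n)))) < ereal v"
    using L v(1) by simp
  then obtain \<beta> where \<beta>: "max 0 (limsup (\<lambda>n. ereal (ln (real (Suc n)) / - ln (r n)))) < ereal \<beta>"
    "ereal \<beta> < ereal v" using ereal_dense2 by blast
  then have \<beta>_pos: "0 < \<beta>" and \<beta>v: "\<beta> < v" by auto
  have "\<forall>\<^sub>F n in sequentially. ereal (ln (real (Suc n)) / - ln (r n)) < ereal \<beta>"
    using \<beta>(1) by (intro Limsup_lessD) simp
  moreover have "\<forall>\<^sub>F n in sequentially. r n < 1"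
    using order_tendstoD(2)[OF r(2), of 1] by simp
  ultimately have "\<forall>\<^sub>F n in sequentially. norm (r n powr v) \<le> real (Suc n) powr (- v / \<beta>)"
  proof eventually_elim
    case (elim n)
    have "0 < - ln (r n)" using r(1)[of n] elim(2) by simp
    moreover have "ln (real (Suc n)) / - ln (r n) < \<beta>"
      using elim(1) by (simp only: less_ereal.simps)
    ultimately have "ln (real (Suc n)) < \<beta> * - ln (r n)"
      by (simp only: pos_divide_less_eq)
    then have "ln (r n) \<le> - (1 / \<beta>) * ln (real (Suc n))"
      using \<beta>_pos by (simp add: field_simps)
    then have "exp (v * ln (r n)) \<le> exp (v * (- (1 / \<beta>) * ln (real (Suc n))))"
      using v(1) by (subst exp_le_cancel_iff) (rule mult_left_mono, auto)
    then show ?case using r(1)[of n] by (simp add: powr_def del: of_nat_Suc)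
  qed
  moreover have "summable (\<lambda>n. real (Suc n) powr (- v / \<beta>))"
  proof -
    have "summable (\<lambda>n. of_nat n powr (- v / \<beta>) :: real)"
      using \<beta>_pos \<beta>v by (subst summable_real_powr_iff) (simp add: field_simps)
    then show ?thesis by (subst summable_Suc_iff)
  qed
  ultimately show ?thesis by (rule summable_comparison_test_ev)
qed

lemma critical_exponent_bounds:
  assumes r: "\<And>n. 0 < r n" "r \<longlonglongrightarrow> 0" and t: "0 < t"
  obtains a where "critical_exponent t r = ereal a" "0 \<le> a" "a \<le> t"
proof -
  have "\<forall>\<^sub>F n in sequentially. r n < 1"
    using order_tendstoD(2)[OF r(2), of 1] by simp
  then have "\<forall>\<^sub>F n in sequentially. 0 \<le> ereal (ln (real (Suc n)) / - ln (r n))"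
  proof eventually_elim
    case (elim n)
    then have "ln (r n) < 0" using r(1)[of n] by simp
    then show ?case by (simp add: divide_nonneg_neg del: of_nat_Suc)
  qed
  then have "0 \<le> limsup (\<lambda>n. ereal (ln (real (Suc n)) / - ln (r n)))"
    by (intro le_Limsup) auto
  then have "0 \<le> critical_exponent t r" "critical_exponent t r \<le> ereal t"
    using t unfolding critical_exponent_def by auto
  then show thesis using that by (cases "critical_exponent t r") auto
qed

section \<open>Hitting probabilities\<close>

text \<open>
  The first Borel-Cantelli lemma. The factor \<open>2\<close> leaves room for the closed balls of the covering
  set inside the open neighbourhoods.
\<close>

lemma AE_covering_set_misses:
  fixes \<mu> :: "'a::metric_space measure"
  assumes prob: "prob_space \<mu>" and borel: "sets \<mu> = sets borel" and r: "\<And>n. 0 < r n"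
    and sum: "summable (\<lambda>n. measure \<mu> (nbhd A (2 * r n)))"
  shows "AE x in Pi\<^sub>M UNIV (\<lambda>_. \<mu>). covering_set r x \<inter> A = {}"
proof -
  interpret prob_space \<mu> by fact
  interpret P: product_prob_space "\<lambda>_. \<mu>" "UNIV :: nat set" by unfold_locales
  let ?P = "Pi\<^sub>M UNIV (\<lambda>_ :: nat. \<mu>)"
  define B where "B = (\<lambda>n. {x \<in> space ?P. x n \<in> nbhd A (2 * r n)})"
  have nb: "nbhd A (2 * r n) \<in> sets \<mu>" for n by (simp add: borel open_nbhd)
  have "AE x in ?P. \<forall>\<^sub>F n in sequentially. x \<in> space ?P - B n"
  proof (rule borel_cantelli_AE1)
    show "B n \<in> sets ?P" for n unfolding B_def using nb by measurable
    show "emeasure ?P (B n) < \<infinity>" for n by (simp add: P.emeasure_eq_measure)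
    have "P.prob (B n) = prob (nbhd A (2 * r n))" for n
      using P.emeasure_PiM_Collect_single[of n "nbhd A (2 * r n)"] nb[of n]
      unfolding B_def by (simp add: P.emeasure_eq_measure emeasure_eq_measure)
    then show "summable (\<lambda>n. P.prob (B n))" using sum by simp
  qed
  then show ?thesis
  proof eventually_elim
    case (elim x)
    then obtain N where N: "\<And>n. N \<le> n \<Longrightarrow> x \<in> space ?P - B n"
      unfolding eventually_sequentially by blast
    have "z \<notin> A" if z: "z \<in> covering_set r x" for z
    proof
      assume "z \<in> A"
      obtain n where n: "N \<le> n" "z \<in> cball (x n) (r n)"
        using z unfolding covering_set_def by blast
      then have "x n \<in> ball z (2 * r n)"
        using r[of n] by (simp add: dist_commute)
      then have "x \<in> B n" using N[OF n(1)] \<open>z \<in> A\<close> unfolding B_def nbhd_def by blast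
      then show False using N[OF n(1)] by blast
    qed
    then show ?case by blast
  qed
qed

text \<open>
  Almost sure statements about the product measure decide the hitting event up to a null set, and the
  completion makes it measurable, here and in the opposite case below.
\<close>

lemma hitting_event_null:
  assumes "AE x in Pi\<^sub>M UNIV (\<lambda>_. \<mu>). covering_set r x \<inter> F = {}"
  shows "hitting_event \<mu> r F \<in> sets (centre_space \<mu>) \<and>
    measure (centre_space \<mu>) (hitting_event \<mu> r F) = 0"
proof -
  have "AE x in centre_space \<mu>. \<not> covering_set r x \<inter> F \<noteq> {}"
    unfolding centre_space_def using AE_completion[OF assms] by simp
  then have "hitting_event \<mu> r F \<in> null_sets (centre_space \<mu>)"
    unfolding hitting_event_def centre_space_def completion.AE_iff_null_sets by simp
  then show ?thesis by (auto simp: null_sets_def measure_def)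
qed

lemma hitting_event_almost_sure:
  fixes \<mu> :: "'a::metric_space measure"
  assumes "prob_space \<mu>" and hit: "AE x in Pi\<^sub>M UNIV (\<lambda>_. \<mu>). covering_set r x \<inter> F \<noteq> {}"
  shows "hitting_event \<mu> r F \<in> sets (centre_space \<mu>) \<and>
    measure (centre_space \<mu>) (hitting_event \<mu> r F) = 1"
proof -
  interpret P: prob_space "Pi\<^sub>M UNIV (\<lambda>_ :: nat. \<mu>)"
    using assms(1) by (intro prob_space_PiM)
  interpret Q: prob_space "centre_space \<mu>"
    unfolding centre_space_def by (intro prob_spaceI) (simp add: P.emeasure_space_1)
  have ae: "AE x in centre_space \<mu>. covering_set r x \<inter> F \<noteq> {}"
    unfolding centre_space_def by (rule AE_completion[OF hit])
  then have ae': "AE x in centre_space \<mu>. x \<in> hitting_event \<mu> r F"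
    using AE_space by eventually_elim (simp add: hitting_event_def)
  have "{x \<in> space (centre_space \<mu>). \<not> covering_set r x \<inter> F \<noteq> {}} \<in> null_sets (centre_space \<mu>)"
    using ae unfolding centre_space_def completion.AE_iff_null_sets .
  then have "space (centre_space \<mu>) -
      {x \<in> space (centre_space \<mu>). \<not> covering_set r x \<inter> F \<noteq> {}} \<in> sets (centre_space \<mu>)"
    by (intro sets.compl_sets) (rule null_setsD2)
  also have "space (centre_space \<mu>) - {x \<in> space (centre_space \<mu>). \<not> covering_set r x \<inter> F \<noteq> {}} =
      hitting_event \<mu> r F"
    by (auto simp: hitting_event_def)
  finally have "hitting_event \<mu> r F \<in> sets (centre_space \<mu>)" .
  with ae' show ?thesis by (simp add: Q.AE_in_set_eq_1)
qed

context regular_prob_space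
begin

lemma prob_nbhd_mono: "p \<le> q \<Longrightarrow> prob (nbhd A p) \<le> prob (nbhd A q)"
  by (intro finite_measure_mono nbhd_mono) (simp_all add: sets_borel open_nbhd)

lemma AE_covering_set_misses_packing_null:
  assumes r: "\<And>n. 0 < r n" "r \<longlonglongrightarrow> 0"
    and s: "0 < s" "s < t" "critical_exponent t r < ereal (t - s)"
    and null: "packing_measure s F = 0"
  shows "AE x in Pi\<^sub>M UNIV (\<lambda>_. \<mu>). covering_set r x \<inter> F = {}"
proof -
  have "packing_measure s F < 1" using null by simp
  then obtain U where U: "F \<subseteq> (\<Union>i :: nat. U i)" "(\<Sum>i. packing_premeasure s (U i)) < 1"
    unfolding packing_measure_def INF_less_iff by blast
  have "AE x in Pi\<^sub>M UNIV (\<lambda>_. \<mu>). covering_set r x \<inter> U i = {}" for i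
  proof (rule AE_covering_set_misses[OF prob_space_axioms sets_borel r(1)])
    have "packing_premeasure s (U i) = (\<Sum>i\<in>{i}. packing_premeasure s (U i))" by simp
    also have "\<dots> \<le> (\<Sum>i. packing_premeasure s (U i))" by (rule sum_le_suminf) auto
    also have "\<dots> < \<infinity>" by (rule order.strict_trans[OF U(2)]) simp
    finally obtain K \<delta> where \<delta>: "0 < \<delta>"
      and K: "\<And>q. 0 < q \<Longrightarrow> q < \<delta> \<Longrightarrow> prob (nbhd (U i) (2 * q)) \<le> K * q powr (t - s)"
      by (rule nbhd_volume_le_if_finite_premeasure) blast
    have "\<forall>\<^sub>F n in sequentially. r n < \<delta>"
      using order_tendstoD(2)[OF r(2) \<delta>] .
    then have "\<forall>\<^sub>F n in sequentially. norm (prob (nbhd (U i) (2 * r n))) \<le> K * r n powr (t - s)"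
      by eventually_elim (use K r(1) in auto)
    moreover have "summable (\<lambda>n. K * r n powr (t - s))"
      using s by (intro summable_mult summable_radii_powr[where t = t] r) auto
    ultimately show "summable (\<lambda>n. prob (nbhd (U i) (2 * r n)))"
      by (rule summable_comparison_test_ev)
  qed
  then have "AE x in Pi\<^sub>M UNIV (\<lambda>_. \<mu>). \<forall>i. covering_set r x \<inter> U i = {}"
    by (simp add: AE_all_countable)
  then show ?thesis by eventually_elim (use U(1) in blast)
qed

end

text \<open>
  Both dimensions are infima of this form; \<open>m s\<close> stands for the vanishing of the \<open>s\<close>-dimensional
  measure.
\<close>

lemma null_if_dim_less:
  assumes "Inf {ereal s | s. 0 < s \<and> m s} < ereal b"
  obtains s where "0 < s" "s < b" "m s"
  using assms unfolding Inf_less_iff by auto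

lemma not_null_if_less_dim:
  assumes "ereal b < Inf {ereal s | s. 0 < s \<and> m s}" "0 \<le> b"
  obtains s where "b < s" "\<not> m s"
proof -
  obtain s where s: "ereal b < ereal s" "ereal s < Inf {ereal s | s. 0 < s \<and> m s}"
    using ereal_dense2[OF assms(1)] by blast
  have "\<not> m s"
  proof
    assume "m s"
    then have "Inf {ereal s | s. 0 < s \<and> m s} \<le> ereal s"
      using s(1) assms(2) by (intro Inf_lower) auto
    then show False using s(2) by simp
  qed
  then show thesis using that s(1) by simp
qed

theorem theorem2p2:
  fixes \<mu> :: "'a::metric_space measure"
    and t :: real
    and r :: "nat \<Rightarrow> real"
    and F :: "'a set"
    and \<alpha> :: ereal
  assumes compact: "compact (UNIV :: 'a set)"
    and nontrivial: "\<exists>x y :: 'a. x \<noteq> y"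
    and borel: "sets \<mu> = sets borel"
    and prob: "prob_space \<mu>"
    and t_pos: "0 < t"
    and regular: "ahlfors_regular t \<mu>"
    and r_pos: "\<And>n. 0 < r n"
    and r_dec: "decseq r"
    and r_lim: "r \<longlonglongrightarrow> 0"
    and alpha: "\<alpha> = critical_exponent t r"
    and analytic: "analytic_set TYPE('b::polish_space) F"
  shows "(packing_dim F < ereal t - \<alpha> \<longrightarrow>
           hitting_event \<mu> r F \<in> sets (centre_space \<mu>) \<and>
           measure (centre_space \<mu>) (hitting_event \<mu> r F) = 0) \<and>
         (hausdorff_dim F > ereal t - \<alpha> \<longrightarrow>
           hitting_event \<mu> r F \<in> sets (centre_space \<mu>) \<and>
           measure (centre_space \<mu>) (hitting_event \<mu> r F) = 1) \<and>
         (packing_dim F > ereal t - \<alpha> \<and>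
         (\<exists>k :: nat \<Rightarrow> nat. strict_mono k \<and> (\<forall>i. 0 < k i) \<and>
            (\<lambda>i. real (k (Suc i)) / real (k i)) \<longlonglongrightarrow> 1 \<and>
            (\<lambda>i. log2_nat (scale_count r (k i)) / ereal (real (k i))) \<longlonglongrightarrow> \<alpha>) \<longrightarrow>
           hitting_event \<mu> r F \<in> sets (centre_space \<mu>) \<and>
           measure (centre_space \<mu>) (hitting_event \<mu> r F) = 1)"
proof -
  obtain C where C: "0 < C"
    "\<And>x q. 0 < q \<Longrightarrow> q < diameter (UNIV :: 'a set) \<Longrightarrow>
      inverse C * q powr t \<le> measure \<mu> (cball x q) \<and> measure \<mu> (cball x q) \<le> C * q powr t"
    using regular unfolding ahlfors_regular_def by blast
  have "0 < diameter (UNIV :: 'a set)"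
  proof -
    obtain x y :: 'a where "x \<noteq> y" using nontrivial by blast
    moreover have "dist x y \<le> diameter (UNIV :: 'a set)"
      using compact by (intro diameter_bounded_bound compact_imp_bounded) auto
    ultimately show ?thesis using zero_less_dist_iff[of x y] by linarith
  qed
  then interpret regular_prob_space \<mu> t C "diameter (UNIV :: 'a set)"
    using prob C borel by (auto simp: regular_prob_space_def regular_prob_space_axioms_def)
  obtain a where a: "critical_exponent t r = ereal a" "0 \<le> a" "a \<le> t"
    using critical_exponent_bounds[OF r_pos r_lim t_pos] by blast
  have \<alpha>: "\<alpha> = ereal a" and codim: "ereal t - \<alpha> = ereal (t - a)"
    using alpha a(1) by simp_all
  have misses: "AE x in Pi\<^sub>M UNIV (\<lambda>_. \<mu>). covering_set r x \<inter> F = {}"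
    if dim: "packing_dim F < ereal t - \<alpha>"
  proof -
    obtain s where s: "0 < s" "s < t - a" "packing_measure s F = 0"
      using dim unfolding codim packing_dim_def by (rule null_if_dim_less)
    then show ?thesis
      using a by (intro AE_covering_set_misses_packing_null[of r s] r_pos r_lim) auto
  qed
  have hits_hausdorff: "AE x in Pi\<^sub>M UNIV (\<lambda>_. \<mu>). covering_set r x \<inter> F \<noteq> {}"
    if dim: "ereal t - \<alpha> < hausdorff_dim F"
  proof -
    obtain s where s: "t - a < s" "hausdorff_measure s F \<noteq> 0"
      using not_null_if_less_dim[OF dim[unfolded codim hausdorff_dim_def]] a(3) by auto
    obtain u where u: "t - a < u" "u < s" using dense[OF s(1)] by blast
    show ?thesis
    proof (rule AE_covering_set_hits_analytic[OF prob borel sigma_ideal_hausdorff_null[of s] _ analytic])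
      show "F \<notin> {A. hausdorff_measure s A = 0}" using s(2) by simp
      fix A :: "'a set" assume "A \<notin> {A. hausdorff_measure s A = 0}"
      then have "\<exists>\<delta>>0. \<forall>q. 0 < q \<and> q < \<delta> \<longrightarrow> q powr (t - u) < prob (nbhd A (2 * q))"
        using u s(1) a(3) by (intro nbhd_volume_gt_if_hausdorff_pos) auto
      then obtain \<delta> where "0 < \<delta>"
        "\<And>q. 0 < q \<Longrightarrow> q < \<delta> \<Longrightarrow> q powr (t - u) < prob (nbhd A (2 * q))" by blast
      then show "\<not> summable (\<lambda>n. prob (nbhd A (r n)))"
        using a(1) u(1)
        by (intro not_summable_if_volume_gt[where f = "\<lambda>q. prob (nbhd A q)" and t = t and u = "t - u"]
            prob_nbhd_mono r_pos r_dec r_lim) auto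
    qed
  qed
  have hits_packing: "AE x in Pi\<^sub>M UNIV (\<lambda>_. \<mu>). covering_set r x \<inter> F \<noteq> {}"
    if dim: "ereal t - \<alpha> < packing_dim F" and k: "strict_mono k" "\<And>i. 0 < k i"
      "(\<lambda>i. real (k (Suc i)) / real (k i)) \<longlonglongrightarrow> 1"
      "(\<lambda>i. log2_nat (scale_count r (k i)) / ereal (real (k i))) \<longlonglongrightarrow> \<alpha>" for k
  proof -
    obtain s where s: "t - a < s" "packing_measure s F \<noteq> 0"
      using not_null_if_less_dim[OF dim[unfolded codim packing_dim_def]] a(3) by auto
    obtain u where u: "t - a < u" "u < s" using dense[OF s(1)] by blast
    show ?thesis
    proof (rule AE_covering_set_hits_analytic[OF prob borel sigma_ideal_packing_null[of s] _ analytic])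
      show "F \<notin> {A. packing_measure s A = 0}" using s(2) by simp
      fix A :: "'a set" assume "A \<notin> {A. packing_measure s A = 0}"
      then have "\<exists>q. 0 < q \<and> q < \<delta> \<and> q powr (t - u) < prob (nbhd A (2 * q))" if "0 < \<delta>" for \<delta>
        using u s(1) a(3) that by (intro nbhd_volume_gt_if_packing_pos[of s u]) auto
      then show "\<not> summable (\<lambda>n. prob (nbhd A (r n)))"
        using k(4) u(1) unfolding \<alpha>
        by (intro not_summable_if_volume_gt_frequently[where f = "\<lambda>q. prob (nbhd A q)"
              and u = "t - u" and a = a and k = k] prob_nbhd_mono k(1-3)) auto
    qed
  qed
  show ?thesis
    using misses[THEN hitting_event_null] hits_hausdorff[THEN hitting_event_almost_sure[OF prob]]
      hits_packing[THEN hitting_event_almost_sure[OF prob]] by blast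
qed

end
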